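(* Let $2\le d\le n$ be integers and let $\vec{r}\in\mathbb{Q}_+^n$ be an admissible vector for which there is a constant $c$ with $$k_\ell(\vec{r})\ge c\cdot\frac{n\ell}{d}\quad\text{for all }\ell\in\{1,\dots,d-1\}\qquad\text{and}\qquad c\ge\frac{d}{n}\left(\frac{2d}{d-1}\right).$$ Then there exists $\epsilon>0$ such that, for any admissible vector $\vec{s}\in\mathbb{Q}_+^n$ with $|s_i-r_i|<\epsilon$ for all $i$, the space $\mathrm{PF}_d^{\mathbb{R}}(\vec{s})$ is path-connected.
   Context: For $\vec{s}\in\mathbb{Q}_+^n$, $\mathrm{PF}_d^{\mathbb{R}}(\vec{s})$ is the set of $F=[f_1\ \cdots\ f_n]\in\mathbb{R}^{d\times n}$ with $FF^T=\mathbb{I}_d$ and $\|f_i\|^2=s_i$ for all $i$, with the subspace topology. Let $r_{(1)}\ge\dots\ge r_{(n)}>0$ be the decreasing rearrangement of $\vec{r}=(r_1,\dots,r_n)$. $\vec{r}$ is admissible if $\sum_{i=1}^n r_i = d$ and $\sum_{i=1}^k r_{(i)} \le k$ for all $1\le k\le d-1$ (and likewise for $\vec{s}$). Define $k_\ell(\vec{r}) = \min\{k : \sum_{i=1}^k r_{(i)}>\ell\}$. *)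

theory Defs
  imports "HOL-Analysis.Analysis"
begin

text \<open>
  A matrix in $\mathbb{R}^{d \times n}$ has type \<open>real ^ 'n ^ 'd\<close>, with \<open>d = CARD('d)\<close> and
  \<open>n = CARD('n)\<close>; its columns are the frame vectors. The set below is topologised as a subspace
  of this Euclidean space.
\<close>

definition parseval_frames :: "real ^ 'n \<Rightarrow> (real ^ 'n ^ 'd) set" where
  "parseval_frames s =
     {F. F ** transpose F = mat 1 \<and> (\<forall>i. (norm (column i F))\<^sup>2 = s $ i)}"

definition pos_rational_vec :: "real ^ 'n \<Rightarrow> bool" where
  "pos_rational_vec r \<longleftrightarrow> (\<forall>i. r $ i \<in> \<rat> \<and> 0 < r $ i)"

text \<open>
  The entries of \<open>r\<close>, with multiplicity, in decreasing order. List positions start at 0, so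
  $r_{(i)}$ is the list entry at position \<open>i - 1\<close>.
\<close>

definition decreasing_rearrangement :: "real ^ 'n \<Rightarrow> real list" where
  "decreasing_rearrangement r =
     rev (sorted_list_of_multiset (image_mset (\<lambda>i. r $ i) (mset_set UNIV)))"

text \<open>$\sum_{i=1}^{k} r_{(i)}$ for \<open>k \<le> CARD('n)\<close>; constant in \<open>k\<close> from there on.\<close>

definition top_sum :: "real ^ 'n \<Rightarrow> nat \<Rightarrow> real" where
  "top_sum r k = sum_list (take k (decreasing_rearrangement r))"

definition admissible :: "nat \<Rightarrow> real ^ 'n \<Rightarrow> bool" where
  "admissible d r \<longleftrightarrow>
     (\<Sum>i\<in>UNIV. r $ i) = real d \<and> (\<forall>k\<in>{1..d - 1}. top_sum r k \<le> real k)"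

text \<open>
  For an admissible \<open>r\<close> and \<open>l < d\<close> the minimum exists and is at most \<open>CARD('n)\<close>, because
  \<open>top_sum r CARD('n) = d\<close>.
\<close>

definition k_index :: "nat \<Rightarrow> real ^ 'n \<Rightarrow> nat" where
  "k_index l r = (LEAST k. top_sum r k > real l)"

end

theory Submission
  imports Defs "HOL-Computational_Algebra.Polynomial"
begin

text \<open>
  The idea is geometric invariant theory made explicit. Matrices are acted upon by left multiplication with
  invertible matrices and by positive scaling of the columns. Call a matrix balanceable if its orbit meets
  \<open>parseval_frames s\<close>. Then the representative is unique up to an orthogonal matrix on the left, and its row
  space varies continuously with the matrix. A path of balanceable matrices whose end points are in \<open>parseval_frames s\<close>
  can therefore be deformed into a path inside \<open>parseval_frames s\<close> with the same end points
  (\<open>path_component_of_balanceable_path\<close>). The set of balanceable matrices is much larger, and connecting points there is easy.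

  Everything is expressed through the maximal minors. By Cauchy--Binet, the squared minors of a Parseval frame are, up to
  the factor \<open>d!\<close>, a probability distribution on choices of \<open>d\<close> columns, and the squared norm of a column is the probability
  that it is chosen (\<open>sum_minor_squares_count\<close>). Balancing a matrix amounts to minimising
  \<open>\<Sum>\<sigma>. (minor F \<sigma>)\<^sup>2 exp (\<Sum>j. t (\<sigma> j) - \<Sum>i. s i t i)\<close>, a sum of exponentials of linear forms in \<open>t\<close>. It has a minimum if \<open>s\<close> is
  in the relative interior of the matroid base polytope of \<open>F\<close> (\<open>stable_imp_balanceable\<close>). Continuity of the balanced row space
  is a closed graph statement, proved by comparing two averages with \<open>1 + z \<le> exp z\<close> (\<open>gram_eq_of_balanced_limit\<close>). It
  includes limits at frames that split into orthogonal blocks, where the scalings themselves may diverge; so such frames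
  need no separate treatment.

  The hypothesis on \<open>k_index\<close> enters only through two strict inequalities, inherited by all nearby \<open>s\<close> with coordinate sum \<open>d\<close>:
  every entry is below \<open>1\<close>, and any \<open>d\<close> entries sum to less than \<open>d - 1\<close>. The first makes every matrix with columns in
  general position stable. The second lets one column cross the hyperplanes spanned by others without losing
  stability (\<open>stable_of_exchange\<close>, \<open>exchange_on_segment\<close>). Hence every frame can be perturbed
  into general position and then moved, one column after another, to a fixed matrix of points on the moment curve, all through balanceable
  matrices (\<open>common_balanceable_target\<close>).
\<close>

section \<open>Cauchy--Binet and the column norms of a Parseval frame\<close>

text \<open>
  The maximal minors of \<open>F\<close>, i.e. its Pluecker coordinates. They are indexed by all maps
  \<open>'d \<Rightarrow> 'n\<close> and not by \<open>d\<close>-subsets: every subset then occurs \<open>d!\<close> times, once for each ordering,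
  which explains the factors \<open>fact CARD('d)\<close> below.
\<close>

definition minor :: "real ^ 'n ^ 'd \<Rightarrow> ('d \<Rightarrow> 'n) \<Rightarrow> real" where
  "minor F \<sigma> = det (\<chi> k j. F $ k $ \<sigma> j)"

definition scale_columns :: "real ^ 'n \<Rightarrow> real ^ 'n ^ 'd \<Rightarrow> real ^ 'n ^ 'd" where
  "scale_columns w F = (\<chi> k i. F $ k $ i * w $ i)"

lemma minor_mult:
  fixes B :: "real ^ 'd ^ 'd" and F :: "real ^ 'n ^ 'd"
  shows "minor (B ** F) \<sigma> = det B * minor F \<sigma>"
proof -
  have "(\<chi> k j. (B ** F) $ k $ \<sigma> j) = B ** (\<chi> k j. F $ k $ \<sigma> j)"
    by (simp add: matrix_matrix_mult_def vec_eq_iff)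
  then show ?thesis by (simp add: minor_def det_mul)
qed

lemma minor_permute:
  assumes "p permutes UNIV"
  shows "minor F (\<sigma> \<circ> p) = of_int (sign p) * minor F \<sigma>"
  using det_permute_columns[OF assms, of "\<chi> k j. F $ k $ \<sigma> j"] by (simp add: minor_def)

lemma minor_scale_columns:
  fixes F :: "real ^ 'n ^ 'd"
  shows "minor (scale_columns w F) \<sigma> = (\<Prod>j\<in>UNIV. w $ \<sigma> j) * minor F \<sigma>"
proof -
  have "minor (scale_columns w F) \<sigma> = det (transpose (\<chi> k j. scale_columns w F $ k $ \<sigma> j))"
    by (simp add: minor_def)
  also have "transpose (\<chi> k j. scale_columns w F $ k $ \<sigma> j)
      = (\<chi> j. (w $ \<sigma> j) *s (\<chi> k. F $ k $ \<sigma> j))"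
    by (simp add: transpose_def scale_columns_def vec_eq_iff mult.commute)
  also have "det \<dots> = (\<Prod>j\<in>UNIV. w $ \<sigma> j) * det (\<chi> j k. F $ k $ \<sigma> j)"
    by (rule det_rows_mul)
  also have "(\<chi> j k. F $ k $ \<sigma> j) = transpose (\<chi> k j. F $ k $ \<sigma> j)"
    by (simp add: transpose_def)
  finally show ?thesis by (simp add: minor_def)
qed

lemma minor_not_inj:
  assumes "\<not> inj \<sigma>"
  shows "minor F \<sigma> = 0"
proof -
  from assms obtain a b where "a \<noteq> b" "\<sigma> a = \<sigma> b" by (auto simp: inj_def)
  then show ?thesis unfolding minor_def
    by (intro det_identical_columns[of a b]) (auto simp: column_def)
qed

text \<open>
  Expanding each entry of \<open>F G\<^sup>T\<close> turns the determinant into a sum over \<open>\<sigma>\<close> of a monomial in \<open>F\<close>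
  times a minor of \<open>G\<close>. Averaging over the reorderings \<open>\<sigma> \<circ> p\<close> collects the monomials into the
  corresponding minor of \<open>F\<close>.
\<close>

lemma Cauchy_Binet:
  fixes F G :: "real ^ 'n ^ 'd"
  shows "fact CARD('d) * det (F ** transpose G) = (\<Sum>\<sigma>\<in>UNIV. minor F \<sigma> * minor G \<sigma>)"
proof -
  have PiE: "PiE UNIV (\<lambda>_::'d. UNIV :: 'n set) = UNIV" by auto
  let ?m = "\<lambda>\<sigma>::'d\<Rightarrow>'n. \<Prod>k\<in>UNIV. F $ k $ \<sigma> k"
  have m: "(\<Sum>p | p permutes (UNIV::'d set). of_int (sign p) * (\<Prod>k\<in>UNIV. G $ p k $ \<sigma> k)) = minor G \<sigma>"
    for \<sigma> :: "'d \<Rightarrow> 'n"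
  proof -
    have "minor G \<sigma> = det (transpose (\<chi> k j. G $ k $ \<sigma> j))" by (simp add: minor_def)
    then show ?thesis by (simp add: det_def transpose_def)
  qed
  have "det (F ** transpose G) = (\<Sum>p | p permutes (UNIV::'d set).
      of_int (sign p) * (\<Prod>k\<in>UNIV. \<Sum>i\<in>UNIV. F $ k $ i * G $ p k $ i))"
    by (simp add: det_def matrix_matrix_mult_def transpose_def)
  also have "\<dots> = (\<Sum>p | p permutes (UNIV::'d set).
      of_int (sign p) * (\<Sum>\<sigma>\<in>UNIV. \<Prod>k\<in>UNIV. F $ k $ \<sigma> k * G $ p k $ \<sigma> k))"
    by (subst prod_sum_PiE) (simp_all add: PiE)
  also have "\<dots> = (\<Sum>\<sigma>\<in>UNIV. ?m \<sigma> * (\<Sum>p | p permutes (UNIV::'d set).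
      of_int (sign p) * (\<Prod>k\<in>UNIV. G $ p k $ \<sigma> k)))"
    unfolding sum_distrib_left prod.distrib
    by (subst sum.swap) (simp add: algebra_simps)
  also have "\<dots> = (\<Sum>\<sigma>\<in>UNIV. ?m \<sigma> * minor G \<sigma>)" by (simp only: m)
  finally have det: "det (F ** transpose G) = (\<Sum>\<sigma>\<in>UNIV. ?m \<sigma> * minor G \<sigma>)" .
  \<comment> \<open>reindexing by \<open>p\<close> permutes the columns of the minor and produces the sign of \<open>p\<close>\<close>
  have shift: "(\<Sum>\<sigma>\<in>UNIV. ?m \<sigma> * minor G \<sigma>)
      = (\<Sum>\<sigma>\<in>UNIV. ?m (\<sigma> \<circ> p) * (of_int (sign p) * minor G \<sigma>))"
    if p: "p permutes UNIV" for p :: "'d \<Rightarrow> 'd"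
  proof -
    have "bij_betw (\<lambda>\<sigma>::'d\<Rightarrow>'n. \<sigma> \<circ> p) UNIV UNIV"
      by (rule bij_betw_byWitness[of _ "\<lambda>\<sigma>. \<sigma> \<circ> inv p"])
        (auto simp: o_assoc[symmetric] permutes_inv_o[OF p])
    from sum.reindex_bij_betw[OF this, of "\<lambda>\<sigma>. ?m \<sigma> * minor G \<sigma>"]
    show ?thesis by (simp only: minor_permute[OF p])
  qed
  have "fact CARD('d) * det (F ** transpose G)
      = (\<Sum>p | p permutes (UNIV::'d set). \<Sum>\<sigma>\<in>UNIV. ?m \<sigma> * minor G \<sigma>)"
    by (simp add: det card_permutations)
  also have "\<dots> = (\<Sum>p | p permutes (UNIV::'d set).
      \<Sum>\<sigma>\<in>UNIV. ?m (\<sigma> \<circ> p) * (of_int (sign p) * minor G \<sigma>))"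
    by (rule sum.cong[OF refl], rule shift) simp
  also have "\<dots> = (\<Sum>\<sigma>\<in>UNIV. (\<Sum>p | p permutes (UNIV::'d set).
      of_int (sign p) * ?m (\<sigma> \<circ> p)) * minor G \<sigma>)"
    unfolding sum_distrib_right by (subst sum.swap) (simp add: algebra_simps)
  also have "\<dots> = (\<Sum>\<sigma>\<in>UNIV. minor F \<sigma> * minor G \<sigma>)"
    by (simp add: minor_def det_def)
  finally show ?thesis .
qed

text \<open>
  An orthogonal change of basis makes \<open>g\<close> a multiple of a coordinate vector, and the matrix diagonal.
\<close>

lemma det_one_minus_rank_one:
  fixes g :: "real ^ 'd"
  shows "det (mat 1 - (\<chi> k l. g $ k * g $ l)) = 1 - (norm g)\<^sup>2"
proof -
  obtain a :: 'd where True by simp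
  obtain f :: "real ^ 'd \<Rightarrow> real ^ 'd"
    where f: "orthogonal_transformation f" "f (norm g *\<^sub>R axis a 1) = g"
    using rotation_rightward_line[of g a] by blast
  define Q where "Q = matrix f"
  have Q: "orthogonal_matrix Q" and Qf: "\<And>x. f x = Q *v x"
    using f(1) unfolding Q_def
    by (auto simp: orthogonal_transformation_matrix orthogonal_transformation_linear matrix_works
        matrix_vector_mul_linear)
  have g: "g $ k = norm g * Q $ k $ a" for k
  proof -
    have "g $ k = (Q *v (norm g *\<^sub>R axis a 1)) $ k" using f(2) Qf by simp
    also have "\<dots> = norm g * Q $ k $ a"
      by (simp add: matrix_vector_mult_def axis_def if_distrib cong: if_cong)
    finally show ?thesis .
  qed
  define E :: "real^'d^'d" where "E = (\<chi> k l. if k = a \<and> l = a then (norm g)\<^sup>2 else 0)"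
  have EQ: "E ** transpose Q = (\<chi> k l. if k = a then (norm g)\<^sup>2 * Q $ l $ a else 0)"
    by (auto simp: E_def matrix_matrix_mult_def transpose_def vec_eq_iff if_distrib[of "\<lambda>x. x * _"]
        cong: if_cong)
  have "Q ** (E ** transpose Q) = (\<chi> k l. g $ k * g $ l)"
    unfolding EQ
    by (subst (1 2) g) (auto simp: matrix_matrix_mult_def vec_eq_iff if_distrib[of "\<lambda>x. _ * x"] power2_eq_square
        cong: if_cong)
  note outer = this
  have "mat 1 - (\<chi> k l. g $ k * g $ l) = Q ** (mat 1 - E) ** transpose Q"
  proof -
    have "Q ** (mat 1 - E) ** transpose Q = (Q - Q ** E) ** transpose Q"
      by (simp add: matrix_matrix_mult_def vec_eq_iff right_diff_distrib sum_subtractf mat_def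
          if_distrib[of "\<lambda>x. _ * x"] cong: if_cong)
    also have "\<dots> = Q ** transpose Q - Q ** E ** transpose Q"
      by (simp add: matrix_matrix_mult_def[of "_ - _"] matrix_matrix_mult_def[of Q "transpose Q"]
          matrix_matrix_mult_def[of _ "transpose Q"] vec_eq_iff left_diff_distrib sum_subtractf)
    also have "\<dots> = mat 1 - Q ** (E ** transpose Q)"
      using Q by (simp add: orthogonal_matrix_def matrix_mul_assoc)
    finally show ?thesis using outer by simp
  qed
  then have "det (mat 1 - (\<chi> k l. g $ k * g $ l)) = det (Q ** transpose Q) * det (mat 1 - E)"
    by (simp add: det_mul)
  also have "Q ** transpose Q = mat 1" using Q by (simp add: orthogonal_matrix_def)
  also have "det (mat 1 - E) = (\<Prod>k\<in>UNIV. (mat 1 - E) $ k $ k)"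
    by (rule det_diagonal) (auto simp: mat_def E_def)
  also have "\<dots> = (\<Prod>k\<in>UNIV. if k = a then 1 - (norm g)\<^sup>2 else 1)"
    by (rule prod.cong) (auto simp: mat_def E_def)
  finally show ?thesis by simp
qed

text \<open>
  The squared minors of a Parseval frame, divided by \<open>d!\<close>, form a probability distribution (Cauchy--Binet
  for \<open>G\<close> with itself), and this lemma identifies the probability that column \<open>i\<close> is selected. Deleting
  column \<open>i\<close> keeps exactly the minors without \<open>i\<close>, and by Cauchy--Binet their total is
  \<open>d! det (1 - g g\<^sup>T)\<close> for that column \<open>g\<close>.
\<close>

lemma sum_minor_squares_count:
  fixes G :: "real ^ 'n ^ 'd"
  assumes "G ** transpose G = mat 1"
  shows "(\<Sum>\<sigma>\<in>UNIV. (minor G \<sigma>)\<^sup>2 * (\<Sum>j\<in>UNIV. if \<sigma> j = i then 1 else 0))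
         = fact CARD('d) * (norm (column i G))\<^sup>2"
proof -
  define w :: "real^'n" where "w = (\<chi> l. if l = i then 0 else 1)"
  have "(scale_columns w G ** transpose G) $ k $ l
      = (G ** transpose G) $ k $ l - column i G $ k * column i G $ l" for k l
  proof -
    have "(scale_columns w G ** transpose G) $ k $ l
        = (\<Sum>m\<in>UNIV. G $ k $ m * G $ l $ m - (if m = i then G $ k $ i * G $ l $ i else 0))"
      by (auto simp: scale_columns_def w_def matrix_matrix_mult_def transpose_def intro!: sum.cong)
    then show ?thesis
      by (simp add: sum_subtractf matrix_matrix_mult_def transpose_def column_def)
  qed
  then have "scale_columns w G ** transpose G
      = mat 1 - (\<chi> k l. column i G $ k * column i G $ l)"
    using assms by (simp add: vec_eq_iff)
  then have "fact CARD('d) * (1 - (norm (column i G))\<^sup>2)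
      = (\<Sum>\<sigma>\<in>UNIV. minor (scale_columns w G) \<sigma> * minor G \<sigma>)"
    using Cauchy_Binet[of "scale_columns w G" G] det_one_minus_rank_one[of "column i G"] by simp
  also have "\<dots> = (\<Sum>\<sigma>\<in>UNIV. (minor G \<sigma>)\<^sup>2
      - (minor G \<sigma>)\<^sup>2 * (\<Sum>j\<in>UNIV. if \<sigma> j = i then 1 else 0))"
  proof (rule sum.cong[OF refl])
    fix \<sigma> :: "'d \<Rightarrow> 'n"
    have "(\<Prod>j\<in>UNIV. w $ \<sigma> j) = 1 - (\<Sum>j\<in>UNIV. if \<sigma> j = i then 1 else 0)" if inj: "inj \<sigma>"
    proof (cases "i \<in> range \<sigma>")
      case True
      then obtain a where a: "i = \<sigma> a" by auto
      have "(\<Sum>j\<in>UNIV. if \<sigma> j = i then 1 else 0 :: real) = (\<Sum>j\<in>UNIV. if j = a then 1 else 0)"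
        using inj a by (intro sum.cong) (auto simp: inj_eq)
      moreover have "(\<Prod>j\<in>UNIV. w $ \<sigma> j) = 0" using a by (auto simp: w_def)
      ultimately show ?thesis by simp
    next
      case False
      then have *: "\<sigma> j \<noteq> i" for j by auto
      then show ?thesis by (simp add: w_def)
    qed
    then show "minor (scale_columns w G) \<sigma> * minor G \<sigma> = (minor G \<sigma>)\<^sup>2
      - (minor G \<sigma>)\<^sup>2 * (\<Sum>j\<in>UNIV. if \<sigma> j = i then 1 else 0)"
      using minor_not_inj[of \<sigma> G]
      by (cases "inj \<sigma>") (simp_all add: minor_scale_columns power2_eq_square left_diff_distrib)
  qed
  also have "\<dots> = (\<Sum>\<sigma>\<in>UNIV. minor G \<sigma> * minor G \<sigma>)
      - (\<Sum>\<sigma>\<in>UNIV. (minor G \<sigma>)\<^sup>2 * (\<Sum>j\<in>UNIV. if \<sigma> j = i then 1 else 0))"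
    by (simp add: sum_subtractf power2_eq_square)
  also have "(\<Sum>\<sigma>\<in>UNIV. minor G \<sigma> * minor G \<sigma>) = fact CARD('d)"
    using Cauchy_Binet[of G G] assms by simp
  finally show ?thesis by (simp add: algebra_simps)
qed

section \<open>Continuous orthonormalisation; Pluecker coordinates\<close>

lemma matrix_mult_transpose_row_inner:
  fixes F G :: "real ^ 'n ^ 'd"
  shows "(F ** transpose G) $ k $ l = F $ k \<bullet> G $ l"
  by (simp add: matrix_matrix_mult_def transpose_def inner_vec_def)

lemma det_nz_kernel:
  fixes E :: "real ^ 'd ^ 'd"
  assumes "\<And>x. E *v x = 0 \<Longrightarrow> x = 0"
  shows "det E \<noteq> 0"
  using assms matrix_left_invertible_ker[of E] invertible_det_nz[of E] invertible_left_inverse[of E]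
  by blast

text \<open>
  One pivot of Gram--Schmidt that subtracts the projection onto row \<open>j\<close> from all other rows at once, so
  that the rows may be processed in any order.
\<close>

definition gram_schmidt_step :: "'d \<Rightarrow> real ^ 'n ^ 'd \<Rightarrow> real ^ 'n ^ 'd" where
  "gram_schmidt_step j K = (\<chi> k. if k = j then (1 / norm (K $ j)) *\<^sub>R K $ j
     else K $ k - ((K $ k \<bullet> K $ j) / (norm (K $ j))\<^sup>2) *\<^sub>R K $ j)"

lemma gram_schmidt_step_mult:
  assumes "K $ j \<noteq> 0"
  shows "\<exists>E. det E \<noteq> 0 \<and> gram_schmidt_step j K = E ** K"
proof -
  define c where "c k = (K $ k \<bullet> K $ j) / (norm (K $ j))\<^sup>2" for k
  define E :: "real^'b^'b" where "E = (\<chi> k l. if k = j then (if l = j then 1 / norm (K $ j) else 0)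
     else (if l = k then 1 else 0) - (if l = j then c k else 0))"
  have "det E \<noteq> 0"
  proof (rule det_nz_kernel)
    fix x assume x: "E *v x = 0"
    have "(E *v x) $ j = x $ j / norm (K $ j)"
      by (auto simp: E_def matrix_vector_mult_def if_distrib[of "\<lambda>z. z * _"] cong: if_cong)
    with x assms have xj: "x $ j = 0" by simp
    have "(E *v x) $ k = x $ k" if "k \<noteq> j" for k
      using that xj
      by (simp add: E_def matrix_vector_mult_def left_diff_distrib sum_subtractf
          if_distrib[of "\<lambda>z. z * _"] cong: if_cong)
    with x xj show "x = 0" by (metis vec_eq_iff zero_index)
  qed
  moreover have "gram_schmidt_step j K = E ** K"
  proof -
    have "gram_schmidt_step j K $ k $ m = (E ** K) $ k $ m" for k m
      by (cases "k = j") (simp_all add: gram_schmidt_step_def E_def matrix_matrix_mult_def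
          left_diff_distrib sum_subtractf c_def if_distrib[of "\<lambda>z. z * _"] cong: if_cong)
    then show ?thesis by (simp add: vec_eq_iff)
  qed
  ultimately show ?thesis by blast
qed

lemma row_nonzero_of_gram_det:
  fixes K :: "real ^ 'n ^ 'd"
  assumes "det (K ** transpose K) \<noteq> 0"
  shows "K $ j \<noteq> 0"
proof
  assume K: "K $ j = 0"
  have "row j (K ** transpose K) = 0"
    by (simp only: row_def vec_eq_iff matrix_mult_transpose_row_inner K) simp
  with assms det_zero_row(1) show False by blast
qed

lemma gram_det_mult:
  fixes K :: "real ^ 'n ^ 'd"
  shows "det ((B ** K) ** transpose (B ** K)) = (det B)\<^sup>2 * det (K ** transpose K)"
proof -
  have "(B ** K) ** transpose (B ** K) = B ** (K ** transpose K) ** transpose B"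
    by (simp add: matrix_transpose_mul matrix_mul_assoc)
  then show ?thesis by (simp add: det_mul power2_eq_square)
qed

text \<open>
  Gram--Schmidt as a map: it preserves row spaces, depends continuously on the matrix, and fixes the matrices
  whose rows are already orthonormal. The last property keeps the end points of paths in place. In the
  induction the rows in \<open>S\<close> are orthonormal and orthogonal to all other rows.
\<close>

lemma continuous_orthonormalisation:
  "\<exists>q :: real ^ 'n ^ 'd \<Rightarrow> real ^ 'n ^ 'd. continuous_on {K. det (K ** transpose K) \<noteq> 0} q \<and>
     (\<forall>K. det (K ** transpose K) \<noteq> 0 \<longrightarrow>
        (\<exists>B. det B \<noteq> 0 \<and> q K = B ** K) \<and> q K ** transpose (q K) = mat 1) \<and>
     (\<forall>K. K ** transpose K = mat 1 \<longrightarrow> q K = K)"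
proof -
  let ?D = "{K :: real ^ 'n ^ 'd. det (K ** transpose K) \<noteq> 0}"
  have "\<exists>q :: real ^ 'n ^ 'd \<Rightarrow> real ^ 'n ^ 'd. continuous_on ?D q \<and>
     (\<forall>K\<in>?D. (\<exists>B. det B \<noteq> 0 \<and> q K = B ** K) \<and>
        (\<forall>k\<in>S. \<forall>l. q K $ k \<bullet> q K $ l = (if k = l then 1 else 0))) \<and>
     (\<forall>K. K ** transpose K = mat 1 \<longrightarrow> q K = K)" if "finite S" for S :: "'d set"
    using that
  proof (induction S)
    case empty
    have "\<exists>B. det B \<noteq> 0 \<and> K = B ** K" for K :: "real ^ 'n ^ 'd"
      by (rule exI[of _ "mat 1"]) (simp)
    then show ?case by (intro exI[of _ "\<lambda>K. K"]) auto
  next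
    case (insert j S)
    then obtain q :: "real ^ 'n ^ 'd \<Rightarrow> real ^ 'n ^ 'd" where q: "continuous_on ?D q"
      and B: "\<And>K. K \<in> ?D \<Longrightarrow> \<exists>B. det B \<noteq> 0 \<and> q K = B ** K"
      and on: "\<And>K k l. K \<in> ?D \<Longrightarrow> k \<in> S \<Longrightarrow> q K $ k \<bullet> q K $ l = (if k = l then 1 else 0)"
      and id: "\<And>K. K ** transpose K = mat 1 \<Longrightarrow> q K = K"
      by blast
    have nz: "q K $ j \<noteq> 0" if "K \<in> ?D" for K
      using B[OF that] that by (auto simp: gram_det_mult intro!: row_nonzero_of_gram_det)
    let ?q = "\<lambda>K. gram_schmidt_step j (q K)"
    have "continuous_on ?D ?q"
    proof -
      have "continuous_on ?D (\<lambda>K. if k = j then (1 / norm (q K $ j)) *\<^sub>R q K $ j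
         else q K $ k - ((q K $ k \<bullet> q K $ j) / (norm (q K $ j))\<^sup>2) *\<^sub>R q K $ j)" for k
        using nz by (cases "k = j") (auto intro!: continuous_intros q)
      then show ?thesis unfolding gram_schmidt_step_def by (rule continuous_on_vec_lambda)
    qed
    moreover have "\<exists>B. det B \<noteq> 0 \<and> ?q K = B ** K" if "K \<in> ?D" for K
    proof -
      obtain B where "det B \<noteq> 0" "q K = B ** K" using B[OF \<open>K \<in> ?D\<close>] by blast
      moreover obtain E where "det E \<noteq> 0" "?q K = E ** q K"
        using gram_schmidt_step_mult[OF nz[OF \<open>K \<in> ?D\<close>]] by blast
      ultimately show ?thesis
        by (intro exI[of _ "E ** B"]) (simp add: det_mul matrix_mul_assoc)
    qed
    moreover have "?q K $ k \<bullet> ?q K $ l = (if k = l then 1 else 0)"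
      if KD: "K \<in> ?D" and kS: "k \<in> insert j S" for K k l
    proof -
      have jj: "q K $ j \<bullet> q K $ j = (norm (q K $ j))\<^sup>2" by (simp add: power2_norm_eq_inner)
      have n0: "norm (q K $ j) \<noteq> 0" using nz[OF KD] by simp
      consider "k = j" "l = j" | "k = j" "l \<noteq> j" | "k \<noteq> j" "l = j" "k \<in> S" | "k \<noteq> j" "l \<noteq> j" "k \<in> S"
        using kS by blast
      then show ?thesis
      proof cases
        case 1
        then show ?thesis using n0 by (simp add: gram_schmidt_step_def jj power2_eq_square)
      next
        case 2
        then show ?thesis using n0
          by (simp add: gram_schmidt_step_def jj inner_diff_right inner_commute)
      next
        case 3
        then show ?thesis using n0 on[OF KD 3(3)]
          by (simp add: gram_schmidt_step_def)
      next
        case 4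
        then show ?thesis using on[OF KD 4(3)]
          by (simp add: gram_schmidt_step_def inner_diff_right)
      qed
    qed
    moreover have "?q K = K" if "K ** transpose K = mat 1" for K
    proof -
      have K: "K $ k \<bullet> K $ l = (if k = l then 1 else 0)" for k l
        using matrix_mult_transpose_row_inner[of K K k l] unfolding that by (simp add: mat_def)
      have "norm (K $ j) = 1" using K[of j j] by (simp add: norm_eq_sqrt_inner)
      then show ?thesis unfolding id[OF that] by (simp add: gram_schmidt_step_def vec_eq_iff K)
    qed
    ultimately show ?case by (intro exI[of _ ?q]) blast
  qed
  from this[OF finite_class.finite_UNIV] obtain q :: "real ^ 'n ^ 'd \<Rightarrow> real ^ 'n ^ 'd" where
    q: "continuous_on ?D q"
    "\<forall>K\<in>?D. (\<exists>B. det B \<noteq> 0 \<and> q K = B ** K) \<and>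
        (\<forall>k\<in>UNIV. \<forall>l. q K $ k \<bullet> q K $ l = (if k = l then 1 else 0))"
    "\<forall>K. K ** transpose K = mat 1 \<longrightarrow> q K = K"
    by blast
  have "q K ** transpose (q K) = mat 1" if "K \<in> ?D" for K
    using q(2) that by (auto simp: vec_eq_iff matrix_mult_transpose_row_inner mat_def)
  then show ?thesis using q by (intro exI[of _ q]) auto
qed

text \<open>
  Pluecker coordinates determine the row space: if \<open>A\<close> is a nonsingular maximal submatrix of \<open>F\<close>, Cramer's
  rule expresses \<open>X = A\<^sup>-\<^sup>1 F\<close> by quotients of minors. Two Parseval frames with the same minors
  thus differ by an orthogonal matrix on the left.
\<close>

lemma gram_eq_of_minors_eq:
  fixes F G :: "real ^ 'n ^ 'd"
  assumes F: "F ** transpose F = mat 1" and G: "G ** transpose G = mat 1"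
    and minors: "\<And>\<sigma>. minor F \<sigma> = minor G \<sigma>"
  shows "transpose F ** F = transpose G ** G"
proof -
  have "(\<Sum>\<sigma>\<in>UNIV. minor F \<sigma> * minor F \<sigma>) \<noteq> 0"
    unfolding Cauchy_Binet[symmetric] F by simp
  then obtain \<sigma> where \<sigma>: "minor F \<sigma> \<noteq> 0"
    by (auto elim: sum.not_neutral_contains_not_neutral)
  define X :: "real^'n^'d" where "X = (\<chi> j i. minor F (\<sigma>(j := i)) / minor F \<sigma>)"
  have solve: "(\<chi> k j. H $ k $ \<sigma> j) ** X = H" if H: "\<And>\<sigma>. minor H \<sigma> = minor F \<sigma>" for H :: "real^'n^'d"
  proof -
    let ?A = "\<chi> k j. H $ k $ \<sigma> j"
    have dA: "det ?A \<noteq> 0" using \<sigma> H[of \<sigma>] by (simp add: minor_def)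
    have "?A *v column i X = column i H" for i
    proof -
      have m: "(\<chi> k l. if l = j then column i H $ k else ?A $ k $ l)
          = (\<chi> k l. H $ k $ (\<sigma>(j := i)) l)" for j
        by (simp add: vec_eq_iff column_def)
      have "column i X = (\<chi> j. det (\<chi> k l. if l = j then column i H $ k else ?A $ k $ l) / det ?A)"
        unfolding m minor_def[symmetric] H by (simp add: X_def column_def vec_eq_iff)
      then show ?thesis using cramer[OF dA] by blast
    qed
    then show ?thesis
      by (simp add: vec_eq_iff column_def matrix_vector_mult_def matrix_matrix_mult_def)
  qed
  define A C where "A = (\<chi> k j. F $ k $ \<sigma> j)" and "C = (\<chi> k j. G $ k $ \<sigma> j)"
  have AX: "A ** X = F" and CX: "C ** X = G"
    using solve[of F] solve[of G] minors by (simp_all add: A_def C_def)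
  have "det A \<noteq> 0" using \<sigma> by (simp add: minor_def A_def)
  then obtain A' where A': "A' ** A = mat 1"
    using invertible_det_nz invertible_left_inverse by blast
  define Q where "Q = C ** A'"
  have "G = C ** (A' ** A) ** X" using CX A' by simp
  then have GQ: "G = Q ** F" using AX by (simp add: Q_def flip: matrix_mul_assoc)
  have "Q ** transpose Q = Q ** (F ** transpose F) ** transpose Q" using F by simp
  also have "\<dots> = mat 1"
    using G by (simp add: GQ matrix_transpose_mul matrix_mul_assoc)
  finally have QQ: "transpose Q ** Q = mat 1" using matrix_left_right_inverse by blast
  have "transpose G ** G = transpose F ** (transpose Q ** Q) ** F"
    by (simp add: GQ matrix_transpose_mul matrix_mul_assoc)
  then show ?thesis using QQ by simp
qed

section \<open>Balanced limits\<close>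

text \<open>
  Left multiplication and positive column scaling move \<open>F\<close> to a Parseval frame with squared norms \<open>s\<close>.
  Requiring \<open>det B > 0\<close> lets the minors keep their signs.
\<close>

definition balanceable :: "real ^ 'n \<Rightarrow> real ^ 'n ^ 'd \<Rightarrow> bool" where
  "balanceable s F \<longleftrightarrow> (\<exists>B \<delta>. 0 < det B \<and> (\<forall>i. 0 < \<delta> $ i) \<and>
     B ** scale_columns \<delta> F \<in> parseval_frames s)"

text \<open>
  The vectors \<open>\<chi> i. card (\<sigma> -` {i})\<close> of the bases of \<open>F\<close> are the vertices of its matroid base polytope. For
  \<open>s\<close> with coordinate sum \<open>d\<close>, the condition is that \<open>s\<close> lies in the interior of that polytope relative to the
  hyperplane of vectors with this sum.
\<close>

definition stable :: "real ^ 'n \<Rightarrow> real ^ 'n ^ 'd \<Rightarrow> bool" where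
  "stable s F \<longleftrightarrow> (\<forall>t :: real ^ 'n. (\<exists>i j. t $ i \<noteq> t $ j) \<longrightarrow>
     (\<exists>\<sigma>. minor F \<sigma> \<noteq> 0 \<and> (\<Sum>i\<in>UNIV. s $ i * t $ i) < (\<Sum>j\<in>UNIV. t $ \<sigma> j)))"

lemma parseval_frames_balanceable:
  assumes "F \<in> parseval_frames s"
  shows "balanceable s F"
proof -
  have "mat 1 ** scale_columns (\<chi> i. 1) F = F"
    by (simp add: scale_columns_def vec_eq_iff)
  then show ?thesis using assms unfolding balanceable_def
    by (intro exI[of _ "mat 1"] exI[of _ "\<chi> i. 1"]) simp
qed

lemma sum_minor_squares:
  fixes F :: "real ^ 'n ^ 'd"
  assumes "F ** transpose F = mat 1"
  shows "(\<Sum>\<sigma>\<in>UNIV. (minor F \<sigma>)\<^sup>2) = fact CARD('d)"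
  using Cauchy_Binet[of F F] assms by (simp add: power2_eq_square)

text \<open>
  The average of an additive function of the selected columns is the same for all frames in
  \<open>parseval_frames s\<close>: it only depends on the selection probabilities \<open>s\<close>.
\<close>

lemma sum_minor_squares_affine:
  fixes F :: "real ^ 'n ^ 'd"
  assumes "F \<in> parseval_frames s"
  shows "(\<Sum>\<sigma>\<in>UNIV. (minor F \<sigma>)\<^sup>2 * (a + (\<Sum>j\<in>UNIV. b (\<sigma> j))))
    = fact CARD('d) * (a + (\<Sum>i\<in>UNIV. s $ i * b i))"
proof -
  from assms have F: "F ** transpose F = mat 1" and s: "\<And>i. (norm (column i F))\<^sup>2 = s $ i"
    by (auto simp: parseval_frames_def)
  have count: "(\<Sum>j\<in>UNIV. b (\<sigma> j)) = (\<Sum>i\<in>UNIV. b i * (\<Sum>j\<in>UNIV. if \<sigma> j = i then 1 else 0))"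
    for \<sigma> :: "'d \<Rightarrow> 'n"
    unfolding sum_distrib_left by (subst sum.swap) (simp add: if_distrib cong: if_cong)
  have "(\<Sum>\<sigma>\<in>UNIV. (minor F \<sigma>)\<^sup>2 * (\<Sum>j\<in>UNIV. b (\<sigma> j)))
      = (\<Sum>i\<in>UNIV. b i * (\<Sum>\<sigma>\<in>UNIV. (minor F \<sigma>)\<^sup>2 * (\<Sum>j\<in>UNIV. if \<sigma> j = i then 1 else 0)))"
    unfolding count sum_distrib_left[of "(minor F _)\<^sup>2"] sum_distrib_left[of "b _" _ UNIV]
    by (subst sum.swap) (simp add: mult.left_commute)
  also have "\<dots> = (\<Sum>i\<in>UNIV. b i * (fact CARD('d) * s $ i))"
    by (simp only: sum_minor_squares_count[OF F] s)
  also have "\<dots> = fact CARD('d) * (\<Sum>i\<in>UNIV. s $ i * b i)"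
    by (simp add: sum_distrib_left mult_ac)
  finally show ?thesis
    using sum_minor_squares[OF F]
    by (simp add: distrib_left sum.distrib flip: sum_distrib_right)
qed

lemma continuous_on_minor [continuous_intros]:
  "continuous_on S f \<Longrightarrow> continuous_on S (\<lambda>x. minor (f x) \<sigma>)"
  unfolding minor_def det_def by (simp, intro continuous_intros)

lemma tendsto_minor:
  assumes "(F \<longlongrightarrow> F0) net"
  shows "((\<lambda>k. minor (F k) \<sigma>) \<longlongrightarrow> minor F0 \<sigma>) net"
  by (rule continuous_on_tendsto_compose[OF continuous_on_minor[OF continuous_on_id] assms, of UNIV]) simp_all

text \<open>
  This is what makes balancing continuous. Write \<open>x = minor F0\<close>, \<open>y = minor G0\<close>. Since \<open>G k\<close> and \<open>F k\<close> are
  related by \<open>B k\<close> and \<open>\<delta> k\<close>, their minors have a ratio \<open>exp (\<phi> k \<sigma>)\<close> whose exponent is additive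
  in the selected columns. Hence the averages of \<open>\<phi> k\<close> against the squared minors of \<open>G k\<close> and of
  \<open>F0\<close> agree. The inequality \<open>1 + z \<le> exp z\<close>, applied with \<open>z = -2\<phi>\<close> to the first average and with
  \<open>z = \<phi>\<close> to the second, bounds the common value below by something tending to \<open>0\<close> and above by something
  tending to \<open>\<Sum>x y - d!\<close>. Therefore \<open>\<Sum>x y \<ge> d!\<close>, and as \<open>\<Sum>x\<^sup>2 = \<Sum>y\<^sup>2 = d!\<close>, this forces
  \<open>x = y\<close>. The argument allows \<open>B k\<close> and \<open>\<delta> k\<close> to diverge, as can happen when \<open>F0\<close> decomposes
  orthogonally.
\<close>

lemma gram_eq_of_balanced_limit:
  fixes F G :: "nat \<Rightarrow> real ^ 'n ^ 'd"
  assumes F: "F \<longlonglongrightarrow> F0" and F0: "F0 \<in> parseval_frames s"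
    and G: "G \<longlonglongrightarrow> G0" and Gs: "\<And>k. G k \<in> parseval_frames s" and G0: "G0 \<in> parseval_frames s"
    and GF: "\<And>k. G k = B k ** scale_columns (\<delta> k) (F k)"
    and B: "\<And>k. 0 < det (B k)" and \<delta>: "\<And>k i. 0 < \<delta> k $ i"
  shows "transpose G0 ** G0 = transpose F0 ** F0"
proof -
  let ?N = "fact CARD('d) :: real"
  have par: "H ** transpose H = mat 1" if "H \<in> parseval_frames s" for H :: "real^'n^'d"
    using that by (simp add: parseval_frames_def)
  define \<phi> where "\<phi> k \<sigma> = ln (det (B k)) + (\<Sum>j\<in>UNIV. ln (\<delta> k $ \<sigma> j))" for k and \<sigma> :: "'d \<Rightarrow> 'n"
  have exp_l: "minor (G k) \<sigma> = exp (\<phi> k \<sigma>) * minor (F k) \<sigma>" for k \<sigma>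
    by (simp add: GF minor_mult minor_scale_columns \<phi>_def exp_add exp_sum B \<delta>)
  have moment: "(\<Sum>\<sigma>\<in>UNIV. (minor H \<sigma>)\<^sup>2 * \<phi> k \<sigma>)
      = ?N * (ln (det (B k)) + (\<Sum>i\<in>UNIV. s $ i * ln (\<delta> k $ i)))" if "H \<in> parseval_frames s" for H k
    unfolding \<phi>_def by (rule sum_minor_squares_affine[OF that])
  \<comment> \<open>the average of \<open>\<phi>\<close>, computed with the weights of \<open>G k\<close>, is asymptotically nonnegative\<close>
  have lower: "(?N - (\<Sum>\<sigma>\<in>UNIV. (minor (F k) \<sigma>)\<^sup>2)) / 2 \<le> (\<Sum>\<sigma>\<in>UNIV. (minor F0 \<sigma>)\<^sup>2 * \<phi> k \<sigma>)" for k
  proof -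
    have "(minor (G k) \<sigma>)\<^sup>2 - (minor (F k) \<sigma>)\<^sup>2 \<le> 2 * ((minor (G k) \<sigma>)\<^sup>2 * \<phi> k \<sigma>)" for \<sigma>
    proof -
      have e: "exp (- 2 * \<phi> k \<sigma>) * (exp (\<phi> k \<sigma>))\<^sup>2 = 1"
        by (simp add: power2_eq_square flip: exp_add)
      have "(minor (F k) \<sigma>)\<^sup>2 = exp (- 2 * \<phi> k \<sigma>) * (minor (G k) \<sigma>)\<^sup>2"
        using e by (simp add: exp_l power_mult_distrib flip: mult.assoc)
      moreover have "1 + (- 2 * \<phi> k \<sigma>) \<le> exp (- 2 * \<phi> k \<sigma>)" by (rule exp_ge_add_one_self)
      then have "(1 + (- 2 * \<phi> k \<sigma>)) * (minor (G k) \<sigma>)\<^sup>2 \<le> exp (- 2 * \<phi> k \<sigma>) * (minor (G k) \<sigma>)\<^sup>2"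
        by (rule mult_right_mono) simp
      ultimately show ?thesis by (simp add: algebra_simps)
    qed
    then have "(\<Sum>\<sigma>\<in>UNIV. (minor (G k) \<sigma>)\<^sup>2 - (minor (F k) \<sigma>)\<^sup>2)
        \<le> (\<Sum>\<sigma>\<in>UNIV. 2 * ((minor (G k) \<sigma>)\<^sup>2 * \<phi> k \<sigma>))"
      by (rule sum_mono)
    then show ?thesis
      using moment[OF Gs[of k], of k] moment[OF F0, of k] sum_minor_squares[OF par[OF Gs[of k]]]
      by (simp add: sum_subtractf flip: sum_distrib_left)
  qed
  \<comment> \<open>the same average, with the weights of \<open>F0\<close>; minors vanishing at \<open>F0\<close> have weight \<open>0\<close>, so that the ratio
    is only needed where it converges\<close>
  define R where "R k \<sigma> = (minor F0 \<sigma>)\<^sup>2 * (minor (G k) \<sigma> / minor (F k) \<sigma> - 1)" for k \<sigma>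
  have Rlim: "(\<lambda>k. R k \<sigma>) \<longlonglongrightarrow> minor F0 \<sigma> * minor G0 \<sigma> - (minor F0 \<sigma>)\<^sup>2" for \<sigma>
  proof (cases "minor F0 \<sigma> = 0")
    case True
    then show ?thesis by (simp add: R_def)
  next
    case False
    have "(\<lambda>k. R k \<sigma>) \<longlonglongrightarrow> (minor F0 \<sigma>)\<^sup>2 * (minor G0 \<sigma> / minor F0 \<sigma> - 1)"
      unfolding R_def using False by (intro tendsto_intros tendsto_minor F G)
    moreover have "(minor F0 \<sigma>)\<^sup>2 * (minor G0 \<sigma> / minor F0 \<sigma> - 1)
        = minor F0 \<sigma> * minor G0 \<sigma> - (minor F0 \<sigma>)\<^sup>2"
      using False by (simp add: power2_eq_square right_diff_distrib)
    ultimately show ?thesis by simp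
  qed
  have upper: "\<forall>\<^sub>F k in sequentially. (minor F0 \<sigma>)\<^sup>2 * \<phi> k \<sigma> \<le> R k \<sigma>" for \<sigma>
  proof (cases "minor F0 \<sigma> = 0")
    case True
    then show ?thesis by (simp add: R_def)
  next
    case False
    have "\<forall>\<^sub>F k in sequentially. minor (F k) \<sigma> \<noteq> 0"
      using tendsto_minor[OF F] False by (rule tendsto_imp_eventually_ne)
    then show ?thesis
    proof (rule eventually_mono)
      fix k assume "minor (F k) \<sigma> \<noteq> 0"
      then have "minor (G k) \<sigma> / minor (F k) \<sigma> = exp (\<phi> k \<sigma>)" by (simp add: exp_l)
      then have "\<phi> k \<sigma> \<le> minor (G k) \<sigma> / minor (F k) \<sigma> - 1"
        using exp_ge_add_one_self[of "\<phi> k \<sigma>"] by linarith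
      then show "(minor F0 \<sigma>)\<^sup>2 * \<phi> k \<sigma> \<le> R k \<sigma>" unfolding R_def by (rule mult_left_mono) simp
    qed
  qed
  have "\<forall>\<^sub>F k in sequentially. \<forall>\<sigma>\<in>UNIV. (minor F0 \<sigma>)\<^sup>2 * \<phi> k \<sigma> \<le> R k \<sigma>"
    using upper by (subst eventually_ball_finite_distrib) auto
  then have ev: "\<forall>\<^sub>F k in sequentially. (?N - (\<Sum>\<sigma>\<in>UNIV. (minor (F k) \<sigma>)\<^sup>2)) / 2 \<le> (\<Sum>\<sigma>\<in>UNIV. R k \<sigma>)"
    by (rule eventually_mono) (metis (no_types, lifting) lower order_trans sum_mono)
  have "(\<lambda>k. (?N - (\<Sum>\<sigma>\<in>UNIV. (minor (F k) \<sigma>)\<^sup>2)) / 2) \<longlonglongrightarrow> (?N - (\<Sum>\<sigma>\<in>UNIV. (minor F0 \<sigma>)\<^sup>2)) / 2"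
    by (intro tendsto_intros tendsto_minor F) simp
  moreover have "(\<lambda>k. \<Sum>\<sigma>\<in>UNIV. R k \<sigma>) \<longlonglongrightarrow> (\<Sum>\<sigma>\<in>UNIV. minor F0 \<sigma> * minor G0 \<sigma> - (minor F0 \<sigma>)\<^sup>2)"
    by (intro tendsto_sum Rlim)
  ultimately have "(?N - (\<Sum>\<sigma>\<in>UNIV. (minor F0 \<sigma>)\<^sup>2)) / 2 \<le> (\<Sum>\<sigma>\<in>UNIV. minor F0 \<sigma> * minor G0 \<sigma> - (minor F0 \<sigma>)\<^sup>2)"
    using ev by (intro tendsto_le[OF sequentially_bot])
  then have ge: "?N \<le> (\<Sum>\<sigma>\<in>UNIV. minor F0 \<sigma> * minor G0 \<sigma>)"
    using sum_minor_squares[OF par[OF F0]] by (simp add: sum_subtractf)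
  have "(\<Sum>\<sigma>\<in>UNIV. (minor F0 \<sigma> - minor G0 \<sigma>)\<^sup>2)
      = (\<Sum>\<sigma>\<in>UNIV. (minor F0 \<sigma>)\<^sup>2 + (minor G0 \<sigma>)\<^sup>2 - 2 * (minor F0 \<sigma> * minor G0 \<sigma>))"
    by (simp add: power2_diff mult.assoc)
  also have "\<dots> = 2 * ?N - 2 * (\<Sum>\<sigma>\<in>UNIV. minor F0 \<sigma> * minor G0 \<sigma>)"
    using sum_minor_squares[OF par[OF F0]] sum_minor_squares[OF par[OF G0]]
    by (simp add: sum_subtractf sum.distrib flip: sum_distrib_left)
  finally have "(\<Sum>\<sigma>\<in>UNIV. (minor F0 \<sigma> - minor G0 \<sigma>)\<^sup>2) \<le> 0" using ge by simp
  then have "(\<Sum>\<sigma>\<in>UNIV. (minor F0 \<sigma> - minor G0 \<sigma>)\<^sup>2) = 0" by (meson order_antisym sum_nonneg zero_le_power2)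
  then have "minor G0 \<sigma> = minor F0 \<sigma>" for \<sigma>
    by (subst (asm) sum_nonneg_eq_0_iff) auto
  then show ?thesis by (rule gram_eq_of_minors_eq[OF par[OF G0] par[OF F0]])
qed

section \<open>Stable frames can be balanced\<close>

text \<open>
  The function is a sum of exponentials of linear forms, invariant under adding constants to \<open>t\<close>. Stability says
  that in each direction of the hyperplane \<open>H\<close> some form with positive coefficient increases. By compactness
  of the unit sphere the increase is uniform, so the function is coercive on \<open>H\<close>.
\<close>

lemma stable_potential_attains_min:
  fixes F :: "real ^ 'n ^ 'd"
  assumes st: "stable s F" and sum: "(\<Sum>i\<in>UNIV. s $ i) = real CARD('d)"
  shows "\<exists>t :: real ^ 'n. \<forall>t'.
    (\<Sum>\<sigma>\<in>UNIV. (minor F \<sigma>)\<^sup>2 * exp ((\<Sum>j\<in>UNIV. t $ \<sigma> j) - (\<Sum>i\<in>UNIV. s $ i * t $ i)))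
    \<le> (\<Sum>\<sigma>\<in>UNIV. (minor F \<sigma>)\<^sup>2 * exp ((\<Sum>j\<in>UNIV. t' $ \<sigma> j) - (\<Sum>i\<in>UNIV. s $ i * t' $ i)))"
proof -
  define a :: "('d \<Rightarrow> 'n) \<Rightarrow> real^'n \<Rightarrow> real"
    where "a \<sigma> t = (\<Sum>j\<in>UNIV. t $ \<sigma> j) - (\<Sum>i\<in>UNIV. s $ i * t $ i)" for \<sigma> t
  define \<Psi> where "\<Psi> t = (\<Sum>\<sigma>\<in>UNIV. (minor F \<sigma>)\<^sup>2 * exp (a \<sigma> t))" for t
  define h where "h t = (\<Sum>\<sigma>\<in>UNIV. (minor F \<sigma>)\<^sup>2 * max 0 (a \<sigma> t))" for t
  have cont_a: "continuous_on S (a \<sigma>)" for S \<sigma>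
    unfolding a_def by (intro continuous_intros)
  have h_le: "h t \<le> \<Psi> t" for t
    unfolding h_def \<Psi>_def
  proof (intro sum_mono mult_left_mono)
    fix \<sigma>
    show "max 0 (a \<sigma> t) \<le> exp (a \<sigma> t)"
      using exp_ge_add_one_self[of "a \<sigma> t"] exp_ge_zero[of "a \<sigma> t"] by linarith
  qed simp
  define H :: "(real^'n) set" where "H = {t. (\<Sum>i\<in>UNIV. t $ i) = 0}"
  have H: "closed H"
    unfolding H_def by (intro closed_Collect_eq continuous_intros)
  obtain m where m: "0 < m" "\<And>t. t \<in> H \<Longrightarrow> norm t = 1 \<Longrightarrow> m \<le> h t"
  proof (cases "sphere 0 1 \<inter> H = {}")
    case True
    then show thesis by (intro that[of 1]) auto
  next
    case False
    have "continuous_on (sphere 0 1 \<inter> H) h"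
      unfolding h_def by (intro continuous_intros cont_a)
    moreover have "compact (sphere 0 1 \<inter> H)" by (intro compact_Int_closed H) simp
    ultimately obtain t0 where t0: "t0 \<in> sphere 0 1 \<inter> H" "\<forall>t\<in>sphere 0 1 \<inter> H. h t0 \<le> h t"
      using continuous_attains_inf[OF _ False] by blast
    have "\<exists>i j. t0 $ i \<noteq> t0 $ j"
    proof (rule ccontr)
      assume "\<not> (\<exists>i j. t0 $ i \<noteq> t0 $ j)"
      then obtain x where x: "\<And>i. t0 $ i = x" by metis
      then have "real CARD('n) * x = 0" using t0 by (simp add: H_def)
      then have "t0 = 0" using x by (simp add: vec_eq_iff)
      then show False using t0 by simp
    qed
    then obtain \<sigma> where "minor F \<sigma> \<noteq> 0" "0 < a \<sigma> t0"
      using st unfolding stable_def a_def by fastforce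
    then have "0 < (minor F \<sigma>)\<^sup>2 * max 0 (a \<sigma> t0)" by simp
    also have "\<dots> \<le> h t0" unfolding h_def by (rule member_le_sum) auto
    finally show thesis using t0 by (intro that[of "h t0"]) auto
  qed
  have coercive: "m * norm t \<le> h t" if "t \<in> H" for t
  proof (cases "t = 0")
    case True
    then show ?thesis by (auto simp: h_def intro!: sum_nonneg)
  next
    case False
    let ?u = "t /\<^sub>R norm t"
    have "?u \<in> H" using that by (simp add: H_def flip: sum_divide_distrib sum_distrib_left)
    then have "m \<le> h ?u" using False by (intro m) auto
    moreover have "h t = norm t * h ?u"
    proof -
      have "a \<sigma> (c *\<^sub>R v) = c * a \<sigma> v" for \<sigma> c v
        by (simp add: a_def right_diff_distrib sum_distrib_left mult.left_commute)
      from this[of _ "norm t" ?u] have "a \<sigma> t = norm t * a \<sigma> ?u" for \<sigma>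
        using False by simp
      then have "max 0 (a \<sigma> t) = norm t * max 0 (a \<sigma> ?u)" for \<sigma>
        using False by (simp add: max_mult_distrib_left)
      then show ?thesis by (simp add: h_def sum_distrib_left mult_ac)
    qed
    ultimately show ?thesis using False by simp
  qed
  define R where "R = \<Psi> 0 / m"
  have R: "0 \<le> R" using m(1) by (auto simp: R_def \<Psi>_def intro!: divide_nonneg_pos sum_nonneg)
  have 0: "0 \<in> cball 0 R \<inter> H" using R by (simp add: H_def)
  have "continuous_on (cball 0 R \<inter> H) \<Psi>"
    unfolding \<Psi>_def by (intro continuous_intros cont_a)
  moreover have "compact (cball 0 R \<inter> H)" by (intro compact_Int_closed H) simp
  ultimately obtain t where t: "t \<in> cball 0 R \<inter> H" "\<forall>u\<in>cball 0 R \<inter> H. \<Psi> t \<le> \<Psi> u"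
    using continuous_attains_inf 0 by blast
  have minH: "\<Psi> t \<le> \<Psi> u" if "u \<in> H" for u
  proof (cases "norm u \<le> R")
    case True
    then show ?thesis using t that by simp
  next
    case False
    then have "\<Psi> 0 < m * norm u" using m(1) by (simp add: R_def field_simps)
    also have "\<dots> \<le> \<Psi> u" using coercive[OF that] h_le[of u] by simp
    finally have "\<Psi> 0 < \<Psi> u" .
    moreover have "\<Psi> t \<le> \<Psi> 0" using t(2) 0 by blast
    ultimately show ?thesis by simp
  qed
  have "\<Psi> t \<le> \<Psi> u" for u
  proof -
    define x where "x = (\<Sum>i\<in>UNIV. u $ i) / real CARD('n)"
    define v where "v = (\<chi> i. u $ i - x)"
    have "v \<in> H" by (simp add: H_def v_def sum_subtractf x_def)
    moreover have "a \<sigma> v = a \<sigma> u" for \<sigma>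
      by (simp add: a_def v_def sum_subtractf right_diff_distrib sum flip: sum_distrib_right)
    then have "\<Psi> v = \<Psi> u" by (simp add: \<Psi>_def)
    ultimately show ?thesis using minH by metis
  qed
  then show ?thesis unfolding \<Psi>_def a_def by blast
qed

text \<open>
  The partial derivatives of the potential vanish at a minimum. Multiplied by the common factor
  \<open>exp (\<Sum>i. s i * t i)\<close> this says that \<open>s\<close> gives the selection probabilities for the columns scaled by
  \<open>exp (t / 2)\<close>.
\<close>

lemma potential_critical_point:
  fixes F :: "real ^ 'n ^ 'd"
  assumes min: "\<And>t' :: real ^ 'n.
    (\<Sum>\<sigma>\<in>UNIV. (minor F \<sigma>)\<^sup>2 * exp ((\<Sum>j\<in>UNIV. t $ \<sigma> j) - (\<Sum>i\<in>UNIV. s $ i * t $ i)))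
    \<le> (\<Sum>\<sigma>\<in>UNIV. (minor F \<sigma>)\<^sup>2 * exp ((\<Sum>j\<in>UNIV. t' $ \<sigma> j) - (\<Sum>i\<in>UNIV. s $ i * t' $ i)))"
  shows "(\<Sum>\<sigma>\<in>UNIV. (minor F \<sigma>)\<^sup>2 * exp (\<Sum>j\<in>UNIV. t $ \<sigma> j) * (\<Sum>j\<in>UNIV. if \<sigma> j = i then 1 else 0))
    = s $ i * (\<Sum>\<sigma>\<in>UNIV. (minor F \<sigma>)\<^sup>2 * exp (\<Sum>j\<in>UNIV. t $ \<sigma> j))"
proof -
  define a :: "('d \<Rightarrow> 'n) \<Rightarrow> real^'n \<Rightarrow> real"
    where "a \<sigma> t = (\<Sum>j\<in>UNIV. t $ \<sigma> j) - (\<Sum>i\<in>UNIV. s $ i * t $ i)" for \<sigma> t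
  define \<nu> :: "('d \<Rightarrow> 'n) \<Rightarrow> real" where "\<nu> \<sigma> = (\<Sum>j\<in>UNIV. if \<sigma> j = i then 1 else 0)" for \<sigma>
  define \<psi> where "\<psi> x = (\<Sum>\<sigma>\<in>UNIV. (minor F \<sigma>)\<^sup>2 * exp (a \<sigma> t + x * (\<nu> \<sigma> - s $ i)))" for x :: real
  have line: "a \<sigma> (t + x *\<^sub>R axis i 1) = a \<sigma> t + x * (\<nu> \<sigma> - s $ i)" for \<sigma> x
  proof -
    have "(\<Sum>j\<in>UNIV. axis i (1::real) $ \<sigma> j) = \<nu> \<sigma>"
      unfolding \<nu>_def by (rule sum.cong) (auto simp: axis_def)
    moreover have "(\<Sum>l\<in>UNIV. s $ l * axis i 1 $ l) = s $ i"
      by (simp add: axis_def if_distrib cong: if_cong)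
    ultimately show ?thesis
      by (simp add: a_def sum.distrib distrib_left right_diff_distrib mult.left_commute
          flip: sum_distrib_left)
  qed
  have le: "\<psi> 0 \<le> \<psi> x" for x
  proof -
    have "\<psi> x = (\<Sum>\<sigma>\<in>UNIV. (minor F \<sigma>)\<^sup>2 * exp (a \<sigma> (t + x *\<^sub>R axis i 1)))" for x
      by (simp only: line \<psi>_def)
    from this[of 0] this[of x] show ?thesis
      using min[of "t + x *\<^sub>R axis i 1"] by (simp add: a_def)
  qed
  have "(\<psi> has_real_derivative (\<Sum>\<sigma>\<in>UNIV. (minor F \<sigma>)\<^sup>2 * (exp (a \<sigma> t) * (\<nu> \<sigma> - s $ i)))) (at 0)"
    unfolding \<psi>_def by (auto intro!: derivative_eq_intros sum.cong)
  then have "(\<Sum>\<sigma>\<in>UNIV. (minor F \<sigma>)\<^sup>2 * (exp (a \<sigma> t) * (\<nu> \<sigma> - s $ i))) = 0"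
    by (rule DERIV_local_min[of _ _ _ 1]) (use le in auto)
  moreover have "exp (a \<sigma> t) = exp (\<Sum>j\<in>UNIV. t $ \<sigma> j) * exp (- (\<Sum>i\<in>UNIV. s $ i * t $ i))" for \<sigma>
    by (simp add: a_def flip: exp_add)
  ultimately have "exp (- (\<Sum>i\<in>UNIV. s $ i * t $ i)) *
     (\<Sum>\<sigma>\<in>UNIV. (minor F \<sigma>)\<^sup>2 * exp (\<Sum>j\<in>UNIV. t $ \<sigma> j) * (\<nu> \<sigma> - s $ i)) = 0"
    unfolding sum_distrib_left by (simp add: mult_ac)
  then have "(\<Sum>\<sigma>\<in>UNIV. (minor F \<sigma>)\<^sup>2 * exp (\<Sum>j\<in>UNIV. t $ \<sigma> j) * (\<nu> \<sigma> - s $ i)) = 0"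
    by simp
  then have "(\<Sum>\<sigma>\<in>UNIV. (minor F \<sigma>)\<^sup>2 * exp (\<Sum>j\<in>UNIV. t $ \<sigma> j) * \<nu> \<sigma>)
      = (\<Sum>\<sigma>\<in>UNIV. (minor F \<sigma>)\<^sup>2 * exp (\<Sum>j\<in>UNIV. t $ \<sigma> j) * s $ i)"
    by (simp only: right_diff_distrib sum_subtractf right_minus_eq)
  then show ?thesis
    unfolding \<nu>_def by (simp add: sum_distrib_left mult.commute)
qed

text \<open>
  Flipping the sign of one coordinate changes the orientation; this is used to arrange \<open>det B > 0\<close>.
\<close>

lemma parseval_frames_reflect:
  fixes G :: "real ^ 'n ^ 'd"
  assumes "G \<in> parseval_frames s"
  shows "\<exists>E :: real ^ 'd ^ 'd. det E = -1 \<and> E ** G \<in> parseval_frames s"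
proof -
  obtain a :: 'd where True by simp
  define E :: "real^'d^'d" where "E = (\<chi> k l. if k = l then (if k = a then -1 else 1) else 0)"
  have "det E = (\<Prod>k\<in>UNIV. if k = a then -1 else 1)"
    by (subst det_diagonal) (auto simp: E_def intro!: prod.cong)
  then have "det E = -1" by simp
  have EG: "(E ** G) $ k $ i = (if k = a then - G $ k $ i else G $ k $ i)" for k i
    by (simp add: E_def matrix_matrix_mult_def if_distrib[of "\<lambda>z. z * _"] cong: if_cong)
  have tEG: "(E ** G) $ k = (if k = a then - G $ k else G $ k)" for k
    by (simp add: vec_eq_iff EG)
  have GG: "G $ k \<bullet> G $ l = (if k = l then 1 else 0)" for k l
    using assms matrix_mult_transpose_row_inner[of G G k l]
    by (simp add: parseval_frames_def mat_def)
  have "(E ** G) ** transpose (E ** G) = mat 1"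
    by (simp add: vec_eq_iff matrix_mult_transpose_row_inner tEG GG mat_def)
  moreover have "norm (column i (E ** G)) = norm (column i G)" for i
    by (auto simp: norm_vec_def L2_set_def column_def EG intro!: arg_cong[of _ _ sqrt] sum.cong)
  ultimately show ?thesis using assms \<open>det E = -1\<close>
    by (auto simp: parseval_frames_def intro!: exI[of _ E])
qed

text \<open>
  Scale the columns by \<open>exp (t / 2)\<close> for a minimum \<open>t\<close> of the potential and orthonormalise the rows. The latter
  multiplies all minors by one constant and so keeps the selection probabilities, which are \<open>s\<close>; for a
  Parseval frame these are the squared norms of the columns.
\<close>

lemma stable_imp_balanceable:
  fixes F :: "real ^ 'n ^ 'd"
  assumes st: "stable s F" and sum: "(\<Sum>i\<in>UNIV. s $ i) = real CARD('d)"
    and nz: "minor F \<sigma>0 \<noteq> 0"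
  shows "balanceable s F"
proof -
  let ?N = "fact CARD('d) :: real"
  obtain t :: "real^'n" where t: "\<And>t'.
    (\<Sum>\<sigma>\<in>UNIV. (minor F \<sigma>)\<^sup>2 * exp ((\<Sum>j\<in>UNIV. t $ \<sigma> j) - (\<Sum>i\<in>UNIV. s $ i * t $ i)))
    \<le> (\<Sum>\<sigma>\<in>UNIV. (minor F \<sigma>)\<^sup>2 * exp ((\<Sum>j\<in>UNIV. t' $ \<sigma> j) - (\<Sum>i\<in>UNIV. s $ i * t' $ i)))"
    using stable_potential_attains_min[OF st sum] by blast
  define \<delta> :: "real^'n" where "\<delta> = (\<chi> i. exp (t $ i / 2))"
  define K where "K = scale_columns \<delta> F"
  have mK: "(minor K \<sigma>)\<^sup>2 = (minor F \<sigma>)\<^sup>2 * exp (\<Sum>j\<in>UNIV. t $ \<sigma> j)" for \<sigma>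
  proof -
    have "(\<Prod>j\<in>UNIV. \<delta> $ \<sigma> j) = exp (\<Sum>j\<in>UNIV. t $ \<sigma> j / 2)" by (simp add: \<delta>_def exp_sum)
    also have "\<dots>\<^sup>2 = exp (\<Sum>j\<in>UNIV. t $ \<sigma> j)"
      by (simp add: power2_eq_square flip: exp_add sum_divide_distrib)
    finally show ?thesis by (simp add: K_def minor_scale_columns power_mult_distrib)
  qed
  have "0 < (minor K \<sigma>0)\<^sup>2" using nz by (simp add: mK)
  also have "\<dots> \<le> (\<Sum>\<sigma>\<in>UNIV. (minor K \<sigma>)\<^sup>2)" by (rule member_le_sum) auto
  finally have "det (K ** transpose K) \<noteq> 0"
    using Cauchy_Binet[of K K] by (auto simp: power2_eq_square)
  then obtain B G where B: "det B \<noteq> 0" and G: "G = B ** K" and par: "G ** transpose G = mat 1"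
    using continuous_orthonormalisation by metis
  have mG: "(minor G \<sigma>)\<^sup>2 = (det B)\<^sup>2 * (minor K \<sigma>)\<^sup>2" for \<sigma>
    by (simp add: G minor_mult power_mult_distrib)
  have "(norm (column i G))\<^sup>2 = s $ i" for i
  proof -
    have "?N * (norm (column i G))\<^sup>2
        = (det B)\<^sup>2 * (\<Sum>\<sigma>\<in>UNIV. (minor K \<sigma>)\<^sup>2 * (\<Sum>j\<in>UNIV. if \<sigma> j = i then 1 else 0))"
      unfolding sum_minor_squares_count[OF par, symmetric] mG sum_distrib_left[of "(det B)\<^sup>2"]
      by (simp only: mult.assoc)
    also have "\<dots> = s $ i * (\<Sum>\<sigma>\<in>UNIV. (minor G \<sigma>)\<^sup>2)"
      unfolding mK potential_critical_point[OF t] mG sum_distrib_left[symmetric] by simp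
    finally show ?thesis by (simp add: sum_minor_squares[OF par])
  qed
  with par have Gs: "G \<in> parseval_frames s" by (simp add: parseval_frames_def)
  have "\<exists>B. 0 < det B \<and> B ** K \<in> parseval_frames s"
  proof (cases "0 < det B")
    case True
    then show ?thesis using Gs G by blast
  next
    case False
    obtain E :: "real^'d^'d" where "det E = -1" "E ** G \<in> parseval_frames s"
      using parseval_frames_reflect[OF Gs] by blast
    then show ?thesis using False B
      by (intro exI[of _ "E ** B"]) (simp add: det_mul G matrix_mul_assoc)
  qed
  moreover have "0 < \<delta> $ i" for i by (simp add: \<delta>_def)
  ultimately show ?thesis unfolding balanceable_def K_def by blast
qed

section \<open>From balanceable paths to paths of Parseval frames\<close>

lemma scale_columns_mult:
  fixes F :: "real ^ 'n ^ 'd"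
  shows "scale_columns w (B ** F) = B ** scale_columns w F"
  by (simp add: scale_columns_def matrix_matrix_mult_def vec_eq_iff sum_distrib_right mult.assoc)

lemma scale_columns_scale_columns:
  "scale_columns v (scale_columns w F) = scale_columns (\<chi> i. v $ i * w $ i) F"
  by (simp add: scale_columns_def vec_eq_iff mult_ac)

lemma continuous_on_matrix_mult [continuous_intros]:
  fixes f :: "'a::topological_space \<Rightarrow> real ^ 'n ^ 'm" and g :: "'a \<Rightarrow> real ^ 'p ^ 'n"
  assumes "continuous_on S f" "continuous_on S g"
  shows "continuous_on S (\<lambda>x. f x ** g x)"
  unfolding matrix_matrix_mult_def by (intro continuous_intros assms)

lemma continuous_on_transpose [continuous_intros]:
  fixes f :: "'a::topological_space \<Rightarrow> real ^ 'n ^ 'm"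
  assumes "continuous_on S f"
  shows "continuous_on S (\<lambda>x. transpose (f x))"
  unfolding transpose_def by (intro continuous_intros assms)

lemma continuous_on_scale_columns [continuous_intros]:
  fixes f :: "'a::topological_space \<Rightarrow> real ^ 'n ^ 'm"
  assumes "continuous_on S f"
  shows "continuous_on S (\<lambda>x. scale_columns w (f x))"
  unfolding scale_columns_def by (intro continuous_intros assms)

lemma compact_parseval_frames: "compact (parseval_frames s :: (real ^ 'n ^ 'd) set)"
proof -
  have "closed (parseval_frames s :: (real ^ 'n ^ 'd) set)"
  proof -
    have "parseval_frames s = {F :: real ^ 'n ^ 'd. F ** transpose F = mat 1} \<inter>
        (\<Inter>i. {F. (norm (column i F))\<^sup>2 = s $ i})"
      by (auto simp: parseval_frames_def)
    moreover have "closed {F :: real ^ 'n ^ 'd. F ** transpose F = mat 1}"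
      by (intro closed_Collect_eq continuous_intros)
    moreover have "closed {F :: real ^ 'n ^ 'd. (norm (column i F))\<^sup>2 = s $ i}" for i
      unfolding column_def by (intro closed_Collect_eq continuous_intros)
    ultimately show ?thesis by (simp only:) (intro closed_Int closed_INT ballI)
  qed
  moreover have "bounded (parseval_frames s :: (real ^ 'n ^ 'd) set)"
  proof (rule boundedI)
    fix F :: "real ^ 'n ^ 'd" assume F: "F \<in> parseval_frames s"
    have "norm (F $ k) \<le> 1" for k
      using F matrix_mult_transpose_row_inner[of F F k k]
      by (simp add: parseval_frames_def mat_def norm_eq_sqrt_inner)
    then have "norm F \<le> (\<Sum>k\<in>(UNIV::'d set). 1)"
      unfolding norm_vec_def[of F] by (intro order_trans[OF L2_set_le_sum] sum_mono) auto
    then show "norm F \<le> real CARD('d)" by simp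
  qed
  ultimately show ?thesis by (simp add: compact_eq_bounded_closed)
qed

lemma parseval_frames_orthogonal_mult:
  fixes G :: "real ^ 'n ^ 'd" and Q :: "real ^ 'd ^ 'd"
  assumes G: "G \<in> parseval_frames s" and Q: "(Q ** G) ** transpose (Q ** G) = mat 1"
  shows "Q ** G \<in> parseval_frames s"
proof -
  have GG: "G ** transpose G = mat 1" using G by (simp add: parseval_frames_def)
  have "Q ** transpose Q = Q ** (G ** transpose G) ** transpose Q" by (simp add: GG)
  also have "\<dots> = mat 1" using Q by (simp add: matrix_transpose_mul matrix_mul_assoc)
  finally have "orthogonal_matrix Q"
    using matrix_left_right_inverse by (auto simp: orthogonal_matrix_def)
  then have "norm (Q *v x) = norm x" for x
    using orthogonal_transformation_matrix[of "(*v) Q"] orthogonal_transformation_norm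
    by (auto simp: matrix_vector_mul_linear)
  moreover have "column i (Q ** G) = Q *v column i G" for i
    by (simp add: column_def matrix_matrix_mult_def matrix_vector_mult_def)
  ultimately show ?thesis using G Q by (simp add: parseval_frames_def)
qed

text \<open>
  The version of \<open>gram_eq_of_balanced_limit\<close> for a limit \<open>F0\<close> that is only balanceable: transport the whole sequence by the
  transformation that balances \<open>F0\<close>.
\<close>

lemma gram_eq_of_balanced_orbit_limit:
  fixes F G :: "nat \<Rightarrow> real ^ 'n ^ 'd"
  assumes F: "F \<longlonglongrightarrow> F0" and G: "G \<longlonglongrightarrow> G0"
    and Gs: "\<And>k. G k \<in> parseval_frames s" and G0: "G0 \<in> parseval_frames s"
    and GF: "\<And>k. G k = B k ** scale_columns (\<delta> k) (F k)"
    and B: "\<And>k. 0 < det (B k)" and \<delta>: "\<And>k i. 0 < \<delta> k $ i"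
    and H: "B0 ** scale_columns \<delta>0 F0 \<in> parseval_frames s"
    and B0: "0 < det B0" and \<delta>0: "\<And>i. 0 < \<delta>0 $ i"
  shows "transpose G0 ** G0
    = transpose (B0 ** scale_columns \<delta>0 F0) ** (B0 ** scale_columns \<delta>0 F0)"
proof -
  obtain B' where B': "B' ** B0 = mat 1"
    using B0 invertible_det_nz[of B0] invertible_left_inverse[of B0] by auto
  then have "det B' * det B0 = 1" by (metis det_I det_mul)
  then have dB': "0 < det B'" using B0 by (metis zero_less_mult_pos2 zero_less_one)
  have lim: "(\<lambda>k. B0 ** scale_columns \<delta>0 (F k)) \<longlonglongrightarrow> B0 ** scale_columns \<delta>0 F0"
    by (rule continuous_on_tendsto_compose[OF _ F, of UNIV]) (auto intro!: continuous_intros)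
  have comp: "G k = (B k ** B') **
      scale_columns (\<chi> i. \<delta> k $ i / \<delta>0 $ i) (B0 ** scale_columns \<delta>0 (F k))" for k
  proof -
    have "(\<chi> i. (\<chi> i. \<delta> k $ i / \<delta>0 $ i) $ i * \<delta>0 $ i) = \<delta> k"
      using \<delta>0 by (simp add: vec_eq_iff less_imp_neq[symmetric])
    then have "scale_columns (\<chi> i. \<delta> k $ i / \<delta>0 $ i) (B0 ** scale_columns \<delta>0 (F k))
        = B0 ** scale_columns (\<delta> k) (F k)"
      by (simp only: scale_columns_mult scale_columns_scale_columns)
    moreover have "(B k ** B') ** (B0 ** scale_columns (\<delta> k) (F k))
        = B k ** (B' ** B0) ** scale_columns (\<delta> k) (F k)"
      by (simp only: matrix_mul_assoc)
    ultimately show ?thesis by (simp add: B' GF)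
  qed
  show ?thesis
    by (rule gram_eq_of_balanced_limit[OF lim H G Gs G0 comp]) (simp_all add: det_mul B dB' \<delta> \<delta>0)
qed

text \<open>
  Balance each point \<open>p u\<close> of the path by an arbitrary choice, giving \<open>H u\<close>. The choice need not be continuous, but the
  projection \<open>P u\<close> onto the row space of \<open>H u\<close> is: its graph is closed by the limit lemma, and its values lie in
  a compact set. It remains to lift \<open>P\<close> to frames. The rows of \<open>p u ** P u\<close> depend continuously on \<open>u\<close> and
  still span the row space of \<open>H u\<close>, because \<open>p u\<close> is \<open>H u\<close> up to left multiplication and positive scaling, so
  orthonormalising them gives the desired path. Where \<open>p u\<close> is already in \<open>parseval_frames s\<close>, nothing changes.
\<close>

lemma path_component_of_balanceable_path:
  fixes F G :: "real ^ 'n ^ 'd"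
  assumes pc: "path_component {H. balanceable s H} F G"
    and F: "F \<in> parseval_frames s" and G: "G \<in> parseval_frames s"
  shows "path_component (parseval_frames s) F G"
proof -
  obtain p where p: "path p" "path_image p \<subseteq> {H. balanceable s H}" "p 0 = F" "p 1 = G"
    using pc by (auto simp: path_component_def pathstart_def pathfinish_def)
  have contp: "continuous_on {0..1} p" using p(1) by (simp add: path_def)
  have "\<forall>u\<in>{0..1}. \<exists>B \<delta>. 0 < det B \<and> (\<forall>i. 0 < \<delta> $ i) \<and> B ** scale_columns \<delta> (p u) \<in> parseval_frames s"
    using p(2) by (auto simp: path_image_def balanceable_def)
  then obtain B \<delta> where B: "\<And>u. u \<in> {0..1} \<Longrightarrow> 0 < det (B u)"
    and \<delta>: "\<And>u i. u \<in> {0..1} \<Longrightarrow> 0 < \<delta> u $ i"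
    and par: "\<And>u. u \<in> {0..1} \<Longrightarrow> B u ** scale_columns (\<delta> u) (p u) \<in> parseval_frames s"
    by metis
  define H where "H u = B u ** scale_columns (\<delta> u) (p u)" for u
  define P where "P u = transpose (H u) ** H u" for u
  have H: "H u \<in> parseval_frames s" if "u \<in> {0..1}" for u using par that by (simp add: H_def)
  have lim: "transpose G0 ** G0 = P u"
    if u: "u \<in> {0..1}" and v: "\<And>k. v k \<in> {0..1}" "v \<longlonglongrightarrow> u" and G0: "(\<lambda>k. H (v k)) \<longlonglongrightarrow> G0" "G0 \<in> parseval_frames s"
    for u v G0
  proof -
    have "(\<lambda>k. p (v k)) \<longlonglongrightarrow> p u"
      by (rule continuous_on_tendsto_compose[OF contp v(2) u]) (intro always_eventually allI v(1))
    from gram_eq_of_balanced_orbit_limit[OF this G0(1) H[OF v(1)] G0(2) H_def B[OF v(1)] \<delta>[OF v(1)]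
        par[OF u] B[OF u] \<delta>[OF u]]
    show ?thesis by (simp add: P_def H_def)
  qed
  have same: "P u = transpose (p u) ** p u" if "u \<in> {0..1}" "p u \<in> parseval_frames s" for u
  proof -
    show ?thesis
      using gram_eq_of_balanced_limit[OF tendsto_const that(2) tendsto_const H[OF that(1)] H[OF that(1)] H_def B[OF that(1)] \<delta>[OF that(1)]]
      by (simp add: P_def)
  qed
  have contgram: "continuous_on S (\<lambda>H :: real^'n^'d. transpose H ** H)" for S
    by (intro continuous_intros)
  have contP: "continuous_on {0..1} P"
  proof (rule continuous_from_closed_graph)
    show "compact ((\<lambda>H :: real^'n^'d. transpose H ** H) ` parseval_frames s)"
      by (intro compact_continuous_image contgram compact_parseval_frames)
    show "P \<in> {0..1} \<rightarrow> (\<lambda>H :: real^'n^'d. transpose H ** H) ` parseval_frames s"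
      using H by (auto simp: P_def)
    show "closed ((\<lambda>u. (u, P u)) ` {0..1})"
      unfolding closed_sequential_limits
    proof (intro allI impI)
      fix x :: "nat \<Rightarrow> real \<times> (real^'n^'n)" and l
      assume x: "(\<forall>k. x k \<in> (\<lambda>u. (u, P u)) ` {0..1}) \<and> x \<longlonglongrightarrow> l"
      define v where "v k = fst (x k)" for k
      have v: "v k \<in> {0..1}" and xk: "x k = (v k, P (v k))" for k
      proof -
        obtain u where "u \<in> {0..1}" "x k = (u, P u)" using x by blast
        then show "v k \<in> {0..1}" "x k = (v k, P (v k))" by (simp_all add: v_def)
      qed
      have vl: "v \<longlonglongrightarrow> fst l" and Pl: "(\<lambda>k. P (v k)) \<longlonglongrightarrow> snd l"
        using tendsto_fst[of x l] tendsto_snd[of x l] x by (simp_all add: xk)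
      have l01: "fst l \<in> {0..1}"
        by (rule closed_sequentially[OF closed_real_atLeastAtMost _ vl]) (rule v)
      obtain G0 r where G0: "G0 \<in> parseval_frames s" and r: "strict_mono r"
        and Hl: "((\<lambda>k. H (v k)) \<circ> r) \<longlonglongrightarrow> G0"
      proof -
        have "seq_compact (parseval_frames s :: (real ^ 'n ^ 'd) set)"
          by (rule compact_imp_seq_compact[OF compact_parseval_frames])
        then show thesis
        proof (rule seq_compactE[of _ "\<lambda>k. H (v k)"])
          show "\<forall>k. H (v k) \<in> parseval_frames s" using H[OF v] by blast
        qed (rule that)
      qed
      have "transpose G0 ** G0 = P (fst l)"
      proof (rule lim[OF l01 _ LIMSEQ_subseq_LIMSEQ[OF vl r] _ G0])
        show "(v \<circ> r) k \<in> {0..1}" for k unfolding o_def by (rule v)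
        show "(\<lambda>k. H ((v \<circ> r) k)) \<longlonglongrightarrow> G0" using Hl by (simp add: o_def)
      qed
      moreover have "(\<lambda>k. P (v (r k))) \<longlonglongrightarrow> transpose G0 ** G0"
        unfolding P_def
        by (rule continuous_on_tendsto_compose[OF contgram[of UNIV], of "\<lambda>k. H (v (r k))"])
          (use Hl in \<open>auto simp: o_def\<close>)
      moreover have "(\<lambda>k. P (v (r k))) \<longlonglongrightarrow> snd l"
        using LIMSEQ_subseq_LIMSEQ[OF Pl r] by (simp add: o_def)
      ultimately have "snd l = P (fst l)" using LIMSEQ_unique by metis
      then show "l \<in> (\<lambda>u. (u, P u)) ` {0..1}" using l01 by (intro image_eqI[of _ _ "fst l"]) (simp_all add: prod_eq_iff)
    qed
  qed
  obtain q :: "real ^ 'n ^ 'd \<Rightarrow> real ^ 'n ^ 'd" where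
    q: "continuous_on {K. det (K ** transpose K) \<noteq> 0} q"
      "\<forall>K. det (K ** transpose K) \<noteq> 0 \<longrightarrow>
        (\<exists>B. det B \<noteq> 0 \<and> q K = B ** K) \<and> q K ** transpose (q K) = mat 1"
      "\<forall>K. K ** transpose K = mat 1 \<longrightarrow> q K = K"
    using continuous_orthonormalisation by blast
  have factor: "\<exists>C. det C \<noteq> 0 \<and> p u ** P u = C ** H u" if u: "u \<in> {0..1}" for u
  proof -
    obtain B' where B': "B' ** B u = mat 1"
      using B[OF u] invertible_det_nz[of "B u"] invertible_left_inverse[of "B u"] by auto
    then have "det B' * det (B u) = 1" by (metis det_I det_mul)
    then have dB': "det B' \<noteq> 0" by auto
    define w where "w = (\<chi> i. 1 / \<delta> u $ i)"
    have "B' ** scale_columns w (H u) = (B' ** B u) ** scale_columns w (scale_columns (\<delta> u) (p u))"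
      by (simp only: H_def scale_columns_mult matrix_mul_assoc)
    also have "\<dots> = p u"
    proof -
      have "\<delta> u $ i \<noteq> 0" for i using \<delta>[OF u, of i] by simp
      then show ?thesis by (simp add: B') (simp add: scale_columns_def w_def vec_eq_iff)
    qed
    finally have "p u ** P u = (B' ** (scale_columns w (H u) ** transpose (H u))) ** H u"
      by (simp add: P_def matrix_mul_assoc)
    moreover have "det (scale_columns w (H u) ** transpose (H u)) \<noteq> 0"
    proof -
      have HH: "(\<Sum>\<sigma>\<in>UNIV. (minor (H u) \<sigma>)\<^sup>2) \<noteq> 0"
        using sum_minor_squares[of "H u"] H[OF u] by (simp add: parseval_frames_def)
      then obtain \<sigma> where \<sigma>: "minor (H u) \<sigma> \<noteq> 0"
        by (auto elim: sum.not_neutral_contains_not_neutral)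
      have w: "0 < (\<Prod>j\<in>UNIV. w $ \<sigma> j)" for \<sigma> :: "'d \<Rightarrow> 'n"
        using \<delta>[OF u] by (auto simp: w_def intro!: prod_pos)
      have "0 < (\<Prod>j\<in>UNIV. w $ \<sigma> j) * (minor (H u) \<sigma>)\<^sup>2" using w \<sigma> by simp
      also have "\<dots> \<le> (\<Sum>\<sigma>\<in>UNIV. (\<Prod>j\<in>UNIV. w $ \<sigma> j) * (minor (H u) \<sigma>)\<^sup>2)"
        using w by (intro member_le_sum) (auto simp: less_imp_le)
      also have "\<dots> = fact CARD('d) * det (scale_columns w (H u) ** transpose (H u))"
        by (simp add: Cauchy_Binet minor_scale_columns power2_eq_square mult.assoc)
      finally show ?thesis by auto
    qed
    ultimately show ?thesis using dB'
      by (intro exI[of _ "B' ** (scale_columns w (H u) ** transpose (H u))"]) (simp add: det_mul)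
  qed
  have nz: "det ((p u ** P u) ** transpose (p u ** P u)) \<noteq> 0" if u: "u \<in> {0..1}" for u
  proof -
    obtain C where C: "det C \<noteq> 0" "p u ** P u = C ** H u" using factor[OF u] by blast
    have "H u ** transpose (H u) = mat 1" using H[OF u] by (simp add: parseval_frames_def)
    then show ?thesis unfolding C(2) gram_det_mult using C(1) by simp
  qed
  define \<Gamma> where "\<Gamma> u = q (p u ** P u)" for u
  have "\<Gamma> u \<in> parseval_frames s" if u: "u \<in> {0..1}" for u
  proof -
    obtain C where C: "p u ** P u = C ** H u" using factor[OF u] by blast
    obtain A where A: "q (p u ** P u) = A ** (p u ** P u)" using q(2) nz[OF u] by blast
    have "\<Gamma> u = (A ** C) ** H u" using A unfolding \<Gamma>_def C by (simp add: matrix_mul_assoc)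
    moreover have "\<Gamma> u ** transpose (\<Gamma> u) = mat 1" using q(2) nz[OF u] by (simp add: \<Gamma>_def)
    ultimately show ?thesis using parseval_frames_orthogonal_mult[OF H[OF u]] by metis
  qed
  moreover have "path \<Gamma>"
    unfolding path_def \<Gamma>_def
    by (rule continuous_on_compose2[OF q(1)]) (use nz in \<open>auto intro!: continuous_intros contp contP\<close>)
  moreover have fix_end: "\<Gamma> u = p u" if u: "u \<in> {0..1}" and pu: "p u \<in> parseval_frames s" for u
  proof -
    have 1: "p u ** transpose (p u) = mat 1" using pu by (simp add: parseval_frames_def)
    have "p u ** P u = p u"
      unfolding same[OF u pu] matrix_mul_assoc 1 by simp
    then show ?thesis using q(3) 1 by (simp add: \<Gamma>_def)
  qed
  ultimately show ?thesis
    using F G p(3,4) fix_end[of 0] fix_end[of 1]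
    by (auto simp: path_component_def path_image_def pathstart_def pathfinish_def intro!: exI[of _ \<Gamma>])
qed

section \<open>Stability and general position\<close>

text \<open>
  Given weights \<open>t\<close>, let \<open>T\<close> consist of \<open>d\<close> columns of largest weight and let \<open>\<theta>\<close> be the least weight in \<open>T\<close>. As
  \<open>0 < s < 1\<close>, the weight of \<open>T\<close> exceeds \<open>\<Sum>s t\<close> strictly. If \<open>T\<close> is not a basis, exchanging its lightest column
  for the heaviest column \<open>x\<close> outside gives a basis, at the price \<open>\<delta> = \<theta> - t x\<close>. Outside of \<open>T\<close>, all weights are at least
  \<open>\<delta>\<close> below \<open>\<theta>\<close> and the total of \<open>s\<close> exceeds \<open>1\<close>, so the surplus of \<open>T\<close> pays for the exchange.
\<close>

lemma stable_of_exchange: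
  fixes F :: "real ^ 'n ^ 'd" and s :: "real ^ 'n"
  assumes s0: "\<And>i. 0 < s $ i" and s1: "\<And>i. s $ i < 1"
    and sum: "(\<Sum>i\<in>UNIV. s $ i) = real CARD('d)"
    and top: "\<And>T. card T = CARD('d) \<Longrightarrow> (\<Sum>i\<in>T. s $ i) < real CARD('d) - 1"
    and dn: "CARD('d) \<le> CARD('n)"
    and exch: "\<And>\<sigma> j x. inj \<sigma> \<Longrightarrow> x \<notin> range \<sigma> \<Longrightarrow> minor F \<sigma> \<noteq> 0 \<or> minor F (\<sigma>(j := x)) \<noteq> 0"
  shows "stable s F"
  unfolding stable_def
proof (intro allI impI)
  fix t :: "real ^ 'n" assume nonconst: "\<exists>i j. t $ i \<noteq> t $ j"
  define \<Sigma> where "\<Sigma> \<sigma> = (\<Sum>j\<in>UNIV. t $ \<sigma> j)" for \<sigma> :: "'d \<Rightarrow> 'n"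
  have upd: "\<Sigma> (\<sigma>(j := x)) = \<Sigma> \<sigma> - t $ \<sigma> j + t $ x" for \<sigma> j x
  proof -
    have "\<Sigma> (\<sigma>(j := x)) = t $ x + (\<Sum>l\<in>UNIV - {j}. t $ (\<sigma>(j := x)) l)"
      unfolding \<Sigma>_def by (subst sum.remove[of UNIV j]) auto
    also have "(\<Sum>l\<in>UNIV - {j}. t $ (\<sigma>(j := x)) l) = (\<Sum>l\<in>UNIV - {j}. t $ \<sigma> l)"
      by (rule sum.cong) auto
    also have "\<dots> = \<Sigma> \<sigma> - t $ \<sigma> j"
      by (simp add: \<Sigma>_def sum_diff1)
    finally show ?thesis by linarith
  qed
  obtain \<sigma>0 :: "'d \<Rightarrow> 'n" where "inj \<sigma>0"
    using dn card_le_inj[of "UNIV :: 'd set" "UNIV :: 'n set"] by auto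
  then have ne: "\<Sigma> ` {\<sigma>. inj \<sigma>} \<noteq> {}" by auto
  have fin: "finite (\<Sigma> ` {\<sigma>. inj \<sigma>})" by simp
  obtain \<sigma> where inj: "inj \<sigma>" and "\<Sigma> \<sigma> = Max (\<Sigma> ` {\<sigma>. inj \<sigma>})"
    using Max_in[OF fin ne] by auto
  then have max: "\<Sigma> \<sigma>' \<le> \<Sigma> \<sigma>" if "inj \<sigma>'" for \<sigma>' using fin that by auto
  have below: "t $ x \<le> t $ \<sigma> j" if "x \<notin> range \<sigma>" for x j
  proof -
    have "inj (\<sigma>(j := x))" using inj that by (auto simp: inj_on_def)
    then show ?thesis using max upd by fastforce
  qed
  obtain j0 where j0: "\<And>j. t $ \<sigma> j0 \<le> t $ \<sigma> j"
  proof -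
    have f: "finite (range (\<lambda>j. t $ \<sigma> j))" by simp
    have "Min (range (\<lambda>j. t $ \<sigma> j)) \<in> range (\<lambda>j. t $ \<sigma> j)" by (rule Min_in[OF f]) simp
    then obtain j0 where j0: "Min (range (\<lambda>j. t $ \<sigma> j)) = t $ \<sigma> j0" by (rule rangeE)
    show thesis using Min_le[OF f] by (intro that[of j0]) (auto simp flip: j0)
  qed
  define \<theta> where "\<theta> = t $ \<sigma> j0"
  define T where "T = range \<sigma>"
  have cT: "card T = CARD('d)" using inj by (simp add: T_def card_image)
  have above: "\<theta> \<le> t $ i" if "i \<in> T" for i using that j0 by (auto simp: T_def \<theta>_def)
  have belowT: "t $ i \<le> \<theta>" if "i \<notin> T" for i using that below by (auto simp: T_def \<theta>_def)
  have split: "(\<Sum>i\<in>UNIV. f i) = (\<Sum>i\<in>T. f i) + (\<Sum>i\<in>-T. f i)" for f :: "'n \<Rightarrow> real"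
    by (simp add: Compl_eq_Diff_UNIV sum.subset_diff[of T UNIV])
  define P where "P = (\<Sum>i\<in>T. (1 - s $ i) * (t $ i - \<theta>))"
  define N where "N = (\<Sum>i\<in>-T. s $ i * (\<theta> - t $ i))"
  have gap: "\<Sigma> \<sigma> - (\<Sum>i\<in>UNIV. s $ i * t $ i) = P + N"
  proof -
    have "\<Sigma> \<sigma> = (\<Sum>i\<in>T. t $ i)"
      unfolding \<Sigma>_def T_def by (simp add: sum.reindex[OF inj])
    moreover have "P = (\<Sum>i\<in>T. t $ i) - real CARD('d) * \<theta> - (\<Sum>i\<in>T. s $ i * t $ i) + (\<Sum>i\<in>T. s $ i) * \<theta>"
      by (simp add: P_def algebra_simps sum.distrib sum_subtractf cT sum_distrib_left)
    moreover have "N = (\<Sum>i\<in>-T. s $ i) * \<theta> - (\<Sum>i\<in>-T. s $ i * t $ i)"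
      by (simp add: N_def right_diff_distrib sum_subtractf sum_distrib_right)
    moreover have "(\<Sum>i\<in>-T. s $ i) = real CARD('d) - (\<Sum>i\<in>T. s $ i)"
      using sum split[of "\<lambda>i. s $ i"] by simp
    ultimately show ?thesis using split[of "\<lambda>i. s $ i * t $ i"] by (simp add: left_diff_distrib)
  qed
  have Pterm: "0 \<le> (1 - s $ i) * (t $ i - \<theta>)" if "i \<in> T" for i
    using above[OF that] s1[of i] by simp
  have Nterm: "0 \<le> s $ i * (\<theta> - t $ i)" if "i \<in> -T" for i
    using belowT[of i] that s0[of i] by simp
  have P0: "0 \<le> P" and N0: "0 \<le> N"
    using Pterm Nterm by (auto simp: P_def N_def intro: sum_nonneg)
  have pos: "0 < P + N"
  proof (rule ccontr)
    assume "\<not> 0 < P + N"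
    then have "P = 0" "N = 0" using P0 N0 by auto
    have "(1 - s $ i) * (t $ i - \<theta>) = 0" if "i \<in> T" for i
      by (rule sum_nonneg_0[OF finite Pterm _ that]) (use \<open>P = 0\<close> in \<open>simp_all add: P_def\<close>)
    moreover have "s $ i * (\<theta> - t $ i) = 0" if "i \<in> -T" for i
      by (rule sum_nonneg_0[OF finite Nterm _ that]) (use \<open>N = 0\<close> in \<open>simp_all add: N_def\<close>)
    ultimately have "t $ i = \<theta>" for i
      using s0[of i] s1[of i] by (cases "i \<in> T") fastforce+
    then show False using nonconst by auto
  qed
  have sT: "(\<Sum>i\<in>T. s $ i) < real CARD('d) - 1" by (rule top[OF cT])
  show "\<exists>\<sigma>. minor F \<sigma> \<noteq> 0 \<and> (\<Sum>i\<in>UNIV. s $ i * t $ i) < (\<Sum>j\<in>UNIV. t $ \<sigma> j)"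
  proof (cases "minor F \<sigma> = 0")
    case False
    then show ?thesis using gap pos unfolding \<Sigma>_def by (intro exI[of _ \<sigma>]) simp
  next
    case True
    have "T \<noteq> UNIV" using sT sum by auto
    then have Tne: "(\<lambda>i. t $ i) ` (-T) \<noteq> {}" by auto
    have "Max ((\<lambda>i. t $ i) ` (-T)) \<in> (\<lambda>i. t $ i) ` (-T)" by (rule Max_in[OF _ Tne]) simp
    then obtain x where x: "x \<notin> T" and "t $ x = Max ((\<lambda>i. t $ i) ` (-T))" by auto
    then have xmax: "t $ i \<le> t $ x" if "i \<notin> T" for i using that by auto
    have nz: "minor F (\<sigma>(j0 := x)) \<noteq> 0" using exch[OF inj] x True by (auto simp: T_def)
    define \<delta> where "\<delta> = \<theta> - t $ x"
    have "\<delta> < P + N"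
    proof (cases "\<delta> = 0")
      case True
      then show ?thesis using pos by simp
    next
      case False
      then have \<delta>: "0 < \<delta>" using belowT[OF x] by (simp add: \<delta>_def)
      have "1 < (\<Sum>i\<in>-T. s $ i)" using sT sum split[of "\<lambda>i. s $ i"] by simp
      then have "\<delta> < (\<Sum>i\<in>-T. s $ i) * \<delta>" using \<delta> by simp
      also have "\<dots> \<le> N"
        unfolding N_def sum_distrib_right \<delta>_def using xmax s0
        by (intro sum_mono mult_left_mono) (auto simp: less_imp_le)
      finally show ?thesis using P0 by simp
    qed
    moreover have "\<Sigma> (\<sigma>(j0 := x)) = \<Sigma> \<sigma> - \<delta>" unfolding upd by (simp add: \<delta>_def \<theta>_def)
    ultimately have "(\<Sum>i\<in>UNIV. s $ i * t $ i) < \<Sigma> (\<sigma>(j0 := x))" using gap by simp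
    then show ?thesis using nz unfolding \<Sigma>_def by blast
  qed
qed

text \<open>
  Column \<open>i\<close> moves on the segment from \<open>f\<close> to \<open>g\<close> while the other columns are in general position. If two bases
  related by an exchange degenerate simultaneously, column \<open>i\<close> lies in the intersection of two hyperplanes spanned
  by other columns, which is spanned by \<open>d - 2\<close> columns. These are linearly independent together with
  \<open>f\<close> and \<open>g\<close>, so no point of the segment is in their span. All linear independence arguments are instances of
  Cramer's rule.
\<close>

lemma exchange_on_segment:
  fixes F :: "real ^ 'n ^ 'd" and f g :: "real ^ 'd"
  assumes col: "column i F = (1 - u) *\<^sub>R f + u *\<^sub>R g"
    and avoid: "\<And>\<sigma>. inj \<sigma> \<Longrightarrow> i \<notin> range \<sigma> \<Longrightarrow> minor F \<sigma> \<noteq> 0"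
    and both: "\<And>\<sigma> j j'. inj \<sigma> \<Longrightarrow> i \<notin> range \<sigma> \<Longrightarrow> j \<noteq> j' \<Longrightarrow>
      det (\<chi> k l. if l = j then f $ k else if l = j' then g $ k else F $ k $ \<sigma> l) \<noteq> 0"
    and \<sigma>: "inj \<sigma>" "x \<notin> range \<sigma>"
  shows "minor F \<sigma> \<noteq> 0 \<or> minor F (\<sigma>(j := x)) \<noteq> 0"
proof (rule ccontr)
  assume "\<not> ?thesis"
  then have m0: "minor F \<sigma> = 0" "minor F (\<sigma>(j := x)) = 0" by auto
  have inj': "inj (\<sigma>(l := x))" for l using \<sigma> by (auto simp: inj_on_def)
  from avoid[OF \<sigma>(1)] m0 obtain j' where j': "\<sigma> j' = i" by auto
  have xi: "x \<noteq> i" using \<sigma>(2) j' by auto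
  have notin: "i \<notin> range (\<sigma>(j' := x))"
    using \<sigma>(1) j' xi by (auto simp: inj_def)
  have jj: "j \<noteq> j'" using avoid[OF inj' notin] m0 by auto
  define A :: "real^'d^'d" where "A = (\<chi> k l. F $ k $ (\<sigma>(j' := x)) l)"
  define v where "v = column i F"
  have dA: "det A \<noteq> 0" using avoid[OF inj' notin] by (simp add: A_def minor_def)
  then obtain c where c: "A *v c = v" using cramer by blast
  have "(\<chi> k l. if l = j' then (A *v c) $ k else A $ k $ l) = (\<chi> k l. F $ k $ \<sigma> l)"
    unfolding c by (simp add: vec_eq_iff v_def column_def A_def j')
  \<comment> \<open>\<open>A\<close> replaces the moving column, at position \<open>j'\<close>, by \<open>x\<close>; \<open>c\<close> are the coordinates of the moving column \<open>v\<close>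
    with respect to \<open>A\<close>, and each degenerate basis makes one of them vanish\<close>
  then have cj': "c $ j' = 0"
    using cramer_lemma[of j' A c] m0(1) dA by (simp add: minor_def)
  have "(\<chi> k l. if l = j then (A *v c) $ k else A $ k $ l)
      = (\<chi> k l. F $ k $ (\<sigma>(j := x) \<circ> Transposition.transpose j j') l)"
    using jj unfolding c
    by (simp add: vec_eq_iff v_def column_def A_def j' Transposition.transpose_def)
  then have "c $ j * det A = minor F (\<sigma>(j := x) \<circ> Transposition.transpose j j')"
    using cramer_lemma[of j A c] by (simp add: minor_def)
  also have "\<dots> = 0" by (subst minor_permute) (simp_all add: permutes_swap_id m0)
  finally have cj: "c $ j = 0" using dA by simp
  \<comment> \<open>in the basis \<open>M\<close>, which contains \<open>f\<close> and \<open>g\<close>, the coordinates of \<open>v\<close> at \<open>f\<close> and \<open>g\<close> are \<open>1 - u\<close> and \<open>u\<close>;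
    both would have to vanish\<close>
  define M :: "real^'d^'d"
    where "M = (\<chi> k l. if l = j then f $ k else if l = j' then g $ k else A $ k $ l)"
  have dM: "det M \<noteq> 0" using both[OF inj' notin jj] unfolding M_def A_def vec_lambda_beta .
  have "v = (1 - u) *\<^sub>R column j M + u *\<^sub>R column j' M"
    using jj unfolding v_def col by (simp add: vec_eq_iff M_def column_def)
  also have "\<dots> = M *v (\<chi> l. if l = j then 1 - u else if l = j' then u else 0)"
  proof -
    have "M $ k $ l * (if l = j then 1 - u else if l = j' then u else 0)
        = (if l = j then M $ k $ j * (1 - u) else 0) + (if l = j' then M $ k $ j' * u else 0)" for k l
      using jj by auto
    then show ?thesis by (simp add: vec_eq_iff matrix_vector_mult_def column_def sum.distrib)
  qed
  finally have vM: "M *v (\<chi> l. if l = j then 1 - u else if l = j' then u else 0) = v" ..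
  have drop: "(\<chi> k l. if l = a then w $ k else A $ k $ l) *v c = v" if "c $ a = 0" for a w
  proof -
    have "(if l = a then w $ k else A $ k $ l) * c $ l = A $ k $ l * c $ l" for k l
      using that by auto
    then have "(\<Sum>l\<in>UNIV. (if l = a then w $ k else A $ k $ l) * c $ l) = (\<Sum>l\<in>UNIV. A $ k $ l * c $ l)" for k
      by (simp only:)
    then show ?thesis by (simp add: c[symmetric] matrix_vector_mult_def)
  qed
  have "u * det M = det (\<chi> k l. if l = j' then v $ k else M $ k $ l)"
    using cramer_lemma[of j' M "\<chi> l. if l = j then 1 - u else if l = j' then u else 0"] jj
    unfolding vM by simp
  also have "\<dots> = det (\<chi> k l. if l = j' then v $ k else (\<chi> k l. if l = j then f $ k else A $ k $ l) $ k $ l)"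
    by (rule arg_cong[of _ _ det]) (simp add: vec_eq_iff M_def)
  also have "\<dots> = 0"
    using cramer_lemma[of j' "\<chi> k l. if l = j then f $ k else A $ k $ l" c]
    unfolding drop[OF cj] cj' by simp
  finally have "u = 0" using dM by simp
  have "(1 - u) * det M = det (\<chi> k l. if l = j then v $ k else M $ k $ l)"
    using cramer_lemma[of j M "\<chi> l. if l = j then 1 - u else if l = j' then u else 0"]
    unfolding vM by simp
  also have "\<dots> = det (\<chi> k l. if l = j then v $ k else (\<chi> k l. if l = j' then g $ k else A $ k $ l) $ k $ l)"
    by (rule arg_cong[of _ _ det]) (simp add: vec_eq_iff M_def)
  also have "\<dots> = 0"
    using cramer_lemma[of j "\<chi> k l. if l = j' then g $ k else A $ k $ l" c]
    unfolding drop[OF cj'] cj by simp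
  finally show False using dM \<open>u = 0\<close> by simp
qed

text \<open>
  A vector in the kernel of the transpose is a polynomial of degree below \<open>d\<close> with \<open>d\<close> roots. The exponents come from an enumeration \<open>h\<close>
  of the index type.
\<close>

lemma vandermonde_det_nonzero:
  fixes y :: "'d::finite \<Rightarrow> real" and h :: "'d \<Rightarrow> nat"
  assumes y: "inj y" and h: "inj h" "\<And>k. h k < CARD('d)"
  shows "det (\<chi> k l. y l ^ h k) \<noteq> 0"
proof -
  have "det (\<chi> l k. y l ^ h k) \<noteq> 0"
  proof (rule det_nz_kernel)
    fix c :: "real ^ 'd" assume c: "(\<chi> l k. y l ^ h k) *v c = 0"
    define p where "p = (\<Sum>k\<in>UNIV. monom (c $ k) (h k))"
    have "poly p (y l) = ((\<chi> l k. y l ^ h k) *v c) $ l" for l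
      by (simp add: p_def poly_sum poly_monom matrix_vector_mult_def mult.commute)
    then have root: "poly p (y l) = 0" for l using c by simp
    have "p = 0"
    proof (rule ccontr)
      assume p: "p \<noteq> 0"
      have "degree p \<le> CARD('d) - 1"
        unfolding p_def
      proof (rule degree_sum_le)
        fix k :: 'd
        show "degree (monom (c $ k) (h k)) \<le> CARD('d) - 1"
          using degree_monom_le[of "c $ k" "h k"] h(2)[of k] by simp
      qed simp
      then have "degree p < CARD('d)" using h(2) by (metis One_nat_def Suc_pred le_imp_less_Suc zero_less_card_finite)
      moreover have "CARD('d) = card (range y)" using y by (simp add: card_image)
      moreover have "card (range y) \<le> card {x. poly p x = 0}"
        by (rule card_mono[OF poly_roots_finite[OF p]]) (use root in auto)
      moreover have "card {x. poly p x = 0} \<le> degree p" by (rule card_poly_roots_bound[OF p])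
      ultimately show False by simp
    qed
    have "c $ k = coeff p (h k)" for k
    proof -
      have "coeff p (h k) = (\<Sum>l\<in>UNIV. if l = k then c $ l else 0)"
        unfolding p_def coeff_sum using h(1) by (intro sum.cong) (auto simp: inj_eq)
      then show ?thesis by simp
    qed
    then show "c = 0" using \<open>p = 0\<close> by (simp add: vec_eq_iff)
  qed
  moreover have "(\<chi> k l. y l ^ h k) = transpose (\<chi> l k. y l ^ h k)" by (simp add: transpose_def)
  ultimately show ?thesis by (metis det_transpose)
qed

text \<open>
  The determinant is a polynomial in \<open>u\<close> that does not vanish at \<open>1\<close>.
\<close>

lemma finite_zeros_det_affine:
  fixes a b :: "real ^ 'd ^ 'd"
  assumes "det (a + b) \<noteq> 0"
  shows "finite {u. det (a + u *\<^sub>R b) = 0}"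
proof -
  define q where "q = det (\<chi> k l. [:a $ k $ l, b $ k $ l:])"
  have q: "poly q u = det (a + u *\<^sub>R b)" for u
    by (simp add: q_def det_def poly_sum poly_prod algebra_simps)
  then have "poly q 1 \<noteq> 0" using assms by simp
  then have "q \<noteq> 0" by auto
  from poly_roots_finite[OF this] show ?thesis by (simp add: q)
qed

section \<open>Path-connectedness\<close>

text \<open>
  All inequalities are strict, so for a fixed coordinate sum this is an open condition.
\<close>

definition spread_out :: "nat \<Rightarrow> real ^ 'n \<Rightarrow> bool" where
  "spread_out d s \<longleftrightarrow> (\<forall>i. 0 < s $ i \<and> s $ i < 1) \<and> (\<Sum>i\<in>UNIV. s $ i) = real d \<and>
     (\<forall>T. card T = d \<longrightarrow> (\<Sum>i\<in>T. s $ i) < real d - 1)"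

lemma balanceable_of_exchange:
  fixes F :: "real ^ 'n ^ 'd"
  assumes s: "spread_out CARD('d) s" and dn: "CARD('d) \<le> CARD('n)"
    and exch: "\<And>\<sigma> j x. inj \<sigma> \<Longrightarrow> x \<notin> range \<sigma> \<Longrightarrow> minor F \<sigma> \<noteq> 0 \<or> minor F (\<sigma>(j := x)) \<noteq> 0"
  shows "balanceable s F"
proof -
  obtain \<sigma> :: "'d \<Rightarrow> 'n" where \<sigma>: "inj \<sigma>"
    using dn card_le_inj[of "UNIV :: 'd set" "UNIV :: 'n set"] by auto
  then have "card (range \<sigma>) = CARD('d)" by (simp add: card_image)
  then have "range \<sigma> \<noteq> UNIV" using s unfolding spread_out_def by fastforce
  then obtain x where "x \<notin> range \<sigma>" by blast
  from exch[OF \<sigma> this] obtain \<sigma>0 where "minor F \<sigma>0 \<noteq> 0" by blast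
  moreover have "stable s F"
    using s by (intro stable_of_exchange dn exch) (auto simp: spread_out_def)
  ultimately show ?thesis
    using s by (intro stable_imp_balanceable) (auto simp: spread_out_def)
qed

text \<open>
  The target \<open>V\<close> and an auxiliary \<open>X\<close> have columns on the moment curve, at distinct parameters. A short initial piece of
  the segment from \<open>F\<close> to \<open>X\<close> ends at a matrix \<open>W u0\<close> whose columns are in general position jointly with those of \<open>V\<close>;
  from there the columns are replaced by those of \<open>V\<close> one at a time.
\<close>

lemma common_balanceable_target:
  fixes s :: "real ^ 'n"
  assumes s: "spread_out CARD('d) s" and dn: "CARD('d) \<le> CARD('n)"
  shows "\<exists>V :: real ^ 'n ^ 'd. \<forall>F\<in>parseval_frames s. path_component {H. balanceable s H} F V"
proof -
  obtain h :: "'d \<Rightarrow> nat" where "bij_betw h UNIV {0..<CARD('d)}"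
    using ex_bij_betw_finite_nat[OF finite_class.finite_UNIV] by blast
  then have h: "inj h" "\<And>k. h k < CARD('d)" by (auto simp: bij_betw_def)
  obtain e :: "'n \<times> bool \<Rightarrow> nat" where "bij_betw e UNIV {0..<CARD('n \<times> bool)}"
    using ex_bij_betw_finite_nat[OF finite_class.finite_UNIV] by blast
  then have e: "inj e" by (simp add: bij_betw_def)
  define V :: "real^'n^'d" where "V = (\<chi> k i. real (e (i, True)) ^ h k)"
  define X :: "real^'n^'d" where "X = (\<chi> k i. real (e (i, False)) ^ h k)"
  show ?thesis
  proof (rule exI[of _ V], rule ballI)
    fix F :: "real^'n^'d" assume F: "F \<in> parseval_frames s"
    define W where "W u = (1 - u) *\<^sub>R F + u *\<^sub>R X" for u :: real
    \<comment> \<open>minors with columns taken from both \<open>V\<close> and \<open>W u\<close>, the Boolean selecting the source\<close>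
    define J :: "real \<Rightarrow> ('d \<Rightarrow> 'n \<times> bool) \<Rightarrow> real" where
      "J u \<rho> = det (\<chi> k l. if snd (\<rho> l) then V $ k $ fst (\<rho> l) else W u $ k $ fst (\<rho> l))" for u \<rho>
    have fin: "finite {u. J u \<rho> = 0}" if \<rho>: "inj \<rho>" for \<rho>
    proof -
      define a :: "real^'d^'d" where
        "a = (\<chi> k l. if snd (\<rho> l) then V $ k $ fst (\<rho> l) else F $ k $ fst (\<rho> l))"
      define b :: "real^'d^'d" where
        "b = (\<chi> k l. if snd (\<rho> l) then 0 else X $ k $ fst (\<rho> l) - F $ k $ fst (\<rho> l))"
      have "a + b = (\<chi> k l. real (e (\<rho> l)) ^ h k)"
      proof -
        have "real (e (\<rho> l)) ^ h k = (if snd (\<rho> l) then V $ k $ fst (\<rho> l) else X $ k $ fst (\<rho> l))" for k l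
          by (cases "\<rho> l") (simp add: V_def X_def)
        then show ?thesis by (simp add: a_def b_def vec_eq_iff)
      qed
      moreover have "inj (\<lambda>l. real (e (\<rho> l)))" using inj_compose[OF e \<rho>] by (simp add: inj_def o_def)
      ultimately have "det (a + b) \<noteq> 0"
        using vandermonde_det_nonzero[of "\<lambda>l. real (e (\<rho> l))" h] h by simp
      moreover have "J u \<rho> = det (a + u *\<^sub>R b)" for u
        unfolding J_def by (rule arg_cong[of _ _ det])
          (simp add: vec_eq_iff a_def b_def W_def algebra_simps)
      ultimately show ?thesis using finite_zeros_det_affine by simp
    qed
    then have "finite (\<Union>\<rho>\<in>{\<rho>. inj \<rho>}. {u. J u \<rho> = 0})" by simp
    from finite_set_avoid[OF this, of 0] obtain d where d: "0 < d"
      and avoid: "\<And>u \<rho>. inj \<rho> \<Longrightarrow> J u \<rho> = 0 \<Longrightarrow> u \<noteq> 0 \<Longrightarrow> d \<le> dist 0 u" by auto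
    define u0 where "u0 = d / 2"
    have u0: "0 < u0" using d by (simp add: u0_def)
    have J: "J u \<rho> \<noteq> 0" if "inj \<rho>" "0 < u" "u \<le> u0" for u \<rho>
      using avoid[OF that(1), of u] that d by (auto simp: u0_def)
    have W: "balanceable s (W u)" if "0 \<le> u" "u \<le> u0" for u
    proof (cases "u = 0")
      case True
      then show ?thesis using parseval_frames_balanceable[OF F] by (simp add: W_def)
    next
      case False
      have "minor (W u) \<sigma> \<noteq> 0" if "inj \<sigma>" for \<sigma>
        using J[of "\<lambda>l. (\<sigma> l, False)" u] False \<open>0 \<le> u\<close> \<open>u \<le> u0\<close> that
        by (simp add: J_def minor_def inj_def)
      then show ?thesis by (intro balanceable_of_exchange[OF s dn]) blast
    qed
    have start: "path_component {H. balanceable s H} F (W u0)"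
    proof (rule path_component_linepath, rule subsetI, rule CollectI)
      fix H assume "H \<in> closed_segment F (W u0)"
      then obtain v where v: "0 \<le> v" "v \<le> 1" and H: "H = (1 - v) *\<^sub>R F + v *\<^sub>R W u0"
        by (auto simp: closed_segment_def)
      have "H = W (v * u0)" by (simp add: H W_def algebra_simps)
      then show "balanceable s H" using v u0 by (auto intro!: W simp: mult_le_cancel_right1)
    qed
    define K :: "'n set \<Rightarrow> real^'n^'d"
      where "K S = (\<chi> k i. if i \<in> S then V $ k $ i else W u0 $ k $ i)" for S
    have "path_component {H. balanceable s H} (K {}) (K S)" if "finite S" for S
      using that
    proof (induction S)
      case empty
      have "K {} = W u0" by (simp add: K_def vec_eq_iff)
      then show ?case using W[of u0] u0 by (simp add: path_component_refl)
    next
      case (insert i S)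
      have "path_component {H. balanceable s H} (K S) (K (insert i S))"
      proof (rule path_component_linepath, rule subsetI, rule CollectI)
        fix H assume "H \<in> closed_segment (K S) (K (insert i S))"
        then obtain v where H: "H = (1 - v) *\<^sub>R K S + v *\<^sub>R K (insert i S)"
          by (auto simp: closed_segment_def)
        have Hi: "H $ k $ m = K S $ k $ m" if "m \<noteq> i" for k m
          using that by (simp add: H K_def algebra_simps)
        have col: "column i H = (1 - v) *\<^sub>R column i (W u0) + v *\<^sub>R column i V"
          using insert.hyps by (simp add: H K_def column_def vec_eq_iff)
        show "balanceable s H"
        proof (intro balanceable_of_exchange[OF s dn] exchange_on_segment[OF col])
          fix \<sigma> :: "'d \<Rightarrow> 'n" assume \<sigma>: "inj \<sigma>" "i \<notin> range \<sigma>"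
          then have ne: "\<sigma> l \<noteq> i" for l by auto
          have "minor H \<sigma> = J u0 (\<lambda>l. (\<sigma> l, \<sigma> l \<in> S))"
            unfolding minor_def J_def using ne
            by (intro arg_cong[of _ _ det]) (simp add: vec_eq_iff Hi, simp add: K_def)
          moreover have "inj (\<lambda>l. (\<sigma> l, \<sigma> l \<in> S))" using \<sigma> by (simp add: inj_def)
          ultimately show "minor H \<sigma> \<noteq> 0" using J u0 by simp
        next
          fix \<sigma> :: "'d \<Rightarrow> 'n" and j j' :: 'd
          assume \<sigma>: "inj \<sigma>" "i \<notin> range \<sigma>" and jj: "j \<noteq> j'"
          then have ne: "\<sigma> l \<noteq> i" "i \<noteq> \<sigma> l" for l by auto
          let ?\<rho> = "\<lambda>l. if l = j then (i, False) else if l = j' then (i, True) else (\<sigma> l, \<sigma> l \<in> S)"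
          have "inj ?\<rho>" using \<sigma>(1) ne by (auto simp: inj_def)
          then have "J u0 ?\<rho> \<noteq> 0" using J u0 by simp
          moreover have "J u0 ?\<rho> = det (\<chi> k l. if l = j then column i (W u0) $ k
              else if l = j' then column i V $ k else H $ k $ \<sigma> l)"
            unfolding J_def using ne jj
            by (intro arg_cong[of _ _ det]) (simp add: vec_eq_iff column_def Hi, simp add: K_def)
          ultimately show "det (\<chi> k l. if l = j then column i (W u0) $ k
              else if l = j' then column i V $ k else H $ k $ \<sigma> l) \<noteq> 0" by simp
        qed
      qed
      then show ?case using insert.IH path_component_trans by blast
    qed
    from this[of UNIV] have "path_component {H. balanceable s H} (K {}) (K UNIV)" by simp
    moreover have "K {} = W u0" "K UNIV = V" by (simp_all add: K_def vec_eq_iff)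
    ultimately show "path_component {H. balanceable s H} F V"
      using start path_component_trans by metis
  qed
qed

lemma path_connected_parseval_frames:
  fixes s :: "real ^ 'n"
  assumes s: "spread_out CARD('d) s" and dn: "CARD('d) \<le> CARD('n)"
  shows "path_connected (parseval_frames s :: (real ^ 'n ^ 'd) set)"
proof -
  obtain V :: "real^'n^'d" where V: "\<forall>F\<in>parseval_frames s. path_component {H. balanceable s H} F V"
    using common_balanceable_target[OF s dn] by blast
  show ?thesis
    unfolding path_connected_component
  proof (intro ballI)
    fix F G :: "real^'n^'d" assume FG: "F \<in> parseval_frames s" "G \<in> parseval_frames s"
    have "path_component {H. balanceable s H} F G"
      using V FG path_component_trans path_component_sym by metis
    then show "path_component (parseval_frames s) F G"
      using FG by (rule path_component_of_balanceable_path)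
  qed
qed

lemma sum_mset_le_sum_take:
  fixes xs :: "real list"
  assumes "sorted (rev xs)" and "A \<subseteq># mset xs"
  shows "sum_mset A \<le> sum_list (take (size A) xs)"
  using assms
proof (induction xs arbitrary: A)
  case Nil
  then show ?case by simp
next
  case (Cons x xs)
  have srt: "sorted (rev xs)" and le: "\<And>y. y \<in> set xs \<Longrightarrow> y \<le> x"
    using Cons.prems(1) by (auto simp: sorted_append)
  show ?case
  proof (cases "A = {#}")
    case True
    then show ?thesis by simp
  next
    case False
    define y where "y = (if x \<in># A then x else SOME y. y \<in># A)"
    have y: "y \<in># A"
      using someI_ex[of "\<lambda>y. y \<in># A"] multiset_nonemptyE[OF False] by (auto simp: y_def)
    have sub: "A - {#y#} \<subseteq># mset xs"
    proof (cases "x \<in># A")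
      case True
      then show ?thesis using Cons.prems(2) by (simp add: y_def subset_eq_diff_conv)
    next
      case False
      then have "A \<subseteq># mset xs"
        using Cons.prems(2) by (metis diff_single_trivial mset.simps(2) subset_eq_diff_conv add_mset_add_single)
      then show ?thesis by (meson diff_subset_eq_self subset_mset.order_trans)
    qed
    have "y \<le> x"
      using mset_subset_eqD[OF Cons.prems(2) y] le by auto
    moreover have "sum_mset (A - {#y#}) \<le> sum_list (take (size (A - {#y#})) xs)"
      by (rule Cons.IH[OF srt sub])
    moreover have A: "A = add_mset y (A - {#y#})" using y by simp
    moreover have "sum_mset A = y + sum_mset (A - {#y#})" by (subst A) simp
    moreover have "size A = Suc (size (A - {#y#}))" by (subst A) simp
    ultimately show ?thesis by simp
  qed
qed

lemma sum_le_top_sum: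
  fixes r :: "real ^ 'n"
  shows "(\<Sum>i\<in>T. r $ i) \<le> top_sum r (card T)"
proof -
  let ?xs = "decreasing_rearrangement r"
  have "image_mset (\<lambda>i. r $ i) (mset_set T) \<subseteq># mset ?xs"
    unfolding decreasing_rearrangement_def
    by (simp add: image_mset_subseteq_mono subset_imp_msubset_mset_set)
  moreover have "sorted (rev ?xs)" by (simp add: decreasing_rearrangement_def)
  ultimately have "sum_mset (image_mset (\<lambda>i. r $ i) (mset_set T)) \<le> sum_list (take (card T) ?xs)"
    using sum_mset_le_sum_take[of ?xs "image_mset (\<lambda>i. r $ i) (mset_set T)"] by simp
  then show ?thesis by (simp add: top_sum_def sum_unfold_sum_mset)
qed

text \<open>
  One more positive entry outside of \<open>T\<close> makes the inequality strict.
\<close>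

lemma sum_less_of_k_index:
  fixes r :: "real ^ 'n"
  assumes r: "\<And>i. 0 < r $ i" and k: "Suc (card T) < k_index l r" and T: "T \<noteq> UNIV"
  shows "(\<Sum>i\<in>T. r $ i) < real l"
proof -
  obtain y where y: "y \<notin> T" using T by blast
  then have "(\<Sum>i\<in>T. r $ i) < (\<Sum>i\<in>insert y T. r $ i)" using r by simp
  also have "\<dots> \<le> top_sum r (Suc (card T))" using sum_le_top_sum[of r "insert y T"] y by simp
  also have "\<dots> \<le> real l" using not_less_Least[OF k[unfolded k_index_def]] by simp
  finally show ?thesis .
qed

lemma spread_out_near:
  fixes r :: "real ^ 'n"
  assumes d: "0 < d" and r1: "\<And>i. r $ i < 1"
    and rT: "\<And>T. card T = d \<Longrightarrow> (\<Sum>i\<in>T. r $ i) < real d - 1"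
  shows "\<exists>\<epsilon>>0. \<forall>s :: real ^ 'n. (\<forall>i. 0 < s $ i) \<longrightarrow> (\<Sum>i\<in>UNIV. s $ i) = real d \<longrightarrow>
    (\<forall>i. \<bar>s $ i - r $ i\<bar> < \<epsilon>) \<longrightarrow> spread_out d s"
proof -
  let ?gap = "\<lambda>T. (real d - 1 - (\<Sum>i\<in>T. r $ i)) / real d"
  have "finite (range (\<lambda>i. 1 - r $ i) \<union> ?gap ` {T. card T = d})" by simp
  from finite_set_avoid[OF this, of 0] obtain \<epsilon> where \<epsilon>: "0 < \<epsilon>"
    and avoid: "\<And>x. x \<in> range (\<lambda>i. 1 - r $ i) \<union> ?gap ` {T. card T = d} \<Longrightarrow> x \<noteq> 0 \<Longrightarrow> \<epsilon> \<le> dist 0 x"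
    by blast
  have e1: "\<epsilon> \<le> 1 - r $ i" for i
    using avoid[of "1 - r $ i"] r1[of i] by auto
  have eT: "\<epsilon> \<le> ?gap T" if "card T = d" for T
  proof -
    have pos: "0 < ?gap T" using rT[OF that] d by simp
    have "\<epsilon> \<le> dist 0 (?gap T)"
      by (rule avoid) (use that pos in \<open>blast, linarith\<close>)
    then show ?thesis using pos unfolding dist_real_def by linarith
  qed
  show ?thesis
  proof (intro exI[of _ \<epsilon>] conjI allI impI \<epsilon>)
    fix s :: "real ^ 'n"
    assume s: "\<forall>i. 0 < s $ i" "(\<Sum>i\<in>UNIV. s $ i) = real d" and close: "\<forall>i. \<bar>s $ i - r $ i\<bar> < \<epsilon>"
    have up: "s $ i < r $ i + \<epsilon>" for i using close by (metis abs_less_iff diff_less_eq add.commute)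
    have "s $ i < 1" for i using up[of i] e1[of i] by simp
    moreover have "(\<Sum>i\<in>T. s $ i) < real d - 1" if T: "card T = d" for T
    proof -
      have "T \<noteq> {}" using T d by auto
      then have "(\<Sum>i\<in>T. s $ i) < (\<Sum>i\<in>T. r $ i + \<epsilon>)" by (intro sum_strict_mono up) auto
      also have "\<dots> = (\<Sum>i\<in>T. r $ i) + real d * \<epsilon>" by (simp add: sum.distrib T)
      also have "\<dots> \<le> real d - 1" using eT[OF T] d by (simp add: field_simps)
      finally show ?thesis .
    qed
    ultimately show "spread_out d s" using s by (simp add: spread_out_def)
  qed
qed

theorem corollary4p9:
  fixes r :: "real ^ 'n" and c :: real
  assumes "2 \<le> CARD('d::finite)" and "CARD('d) \<le> CARD('n)"
    and "pos_rational_vec r" and "admissible CARD('d) r"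
    and "\<forall>l\<in>{1..CARD('d) - 1}.
           real (k_index l r) \<ge> c * (real CARD('n) * real l / real CARD('d))"
    and "c \<ge> real CARD('d) / real CARD('n) * (2 * real CARD('d) / (real CARD('d) - 1))"
  shows "\<exists>\<epsilon>>0. \<forall>s :: real ^ 'n.
           pos_rational_vec s \<longrightarrow> admissible CARD('d) s \<longrightarrow> (\<forall>i. \<bar>s $ i - r $ i\<bar> < \<epsilon>) \<longrightarrow>
           path_connected (parseval_frames s :: (real ^ 'n ^ 'd) set)"
proof -
  let ?d = "CARD('d)" and ?n = "CARD('n)"
  have r0: "0 < r $ i" for i using assms(3) by (simp add: pos_rational_vec_def)
  have sum_r: "(\<Sum>i\<in>UNIV. r $ i) = real ?d" using assms(4) by (simp add: admissible_def)
  have k: "2 * real ?d / (real ?d - 1) * real l \<le> real (k_index l r)" if l: "l \<in> {1..?d - 1}" for l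
  proof -
    have "2 * real ?d / (real ?d - 1) * real l
        = (real ?d / real ?n * (2 * real ?d / (real ?d - 1))) * (real ?n * real l / real ?d)"
      using assms(1) by simp
    also have "\<dots> \<le> c * (real ?n * real l / real ?d)"
      by (rule mult_right_mono[OF assms(6)]) simp
    also have "\<dots> \<le> real (k_index l r)" using assms(5) l by blast
    finally show ?thesis .
  qed
  \<comment> \<open>\<open>l = 1\<close> bounds the sum of the two largest entries by \<open>1\<close>\<close>
  have k1: "2 < k_index 1 r"
  proof -
    have "2 < 2 * real ?d / (real ?d - 1)" using assms(1) by (simp add: field_simps)
    also have "\<dots> \<le> real (k_index 1 r)" using k[of 1] assms(1) by simp
    finally show ?thesis by simp
  qed
  \<comment> \<open>\<open>l = d - 1\<close> bounds the sum of the \<open>2 d - 1\<close> largest entries by \<open>d - 1\<close>; as \<open>d + 1 \<le> 2 d - 1\<close>, the sum of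
    any \<open>d\<close> entries is strictly smaller\<close>
  have kd: "2 * ?d \<le> k_index (?d - 1) r"
  proof -
    have "2 * real ?d / (real ?d - 1) * real (?d - 1) = real (2 * ?d)"
      using assms(1) by (simp add: of_nat_diff)
    moreover have "2 * real ?d / (real ?d - 1) * real (?d - 1) \<le> real (k_index (?d - 1) r)"
      using assms(1) by (intro k) auto
    ultimately show ?thesis by simp
  qed
  have r1: "r $ i < 1" for i
  proof -
    have "{i} \<noteq> UNIV"
    proof
      assume "{i} = UNIV"
      then have "card {i} = ?n" by simp
      then show False using assms(1,2) by simp
    qed
    then show ?thesis using sum_less_of_k_index[OF r0, of "{i}" 1] k1 by simp
  qed
  have rT: "(\<Sum>i\<in>T. r $ i) < real ?d - 1" if T: "card T = ?d" for T
  proof -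
    have small: "Suc (card T) < k_index (?d - 1) r" using kd assms(1) T by linarith
    have "T \<noteq> UNIV"
    proof
      assume "T = UNIV"
      then have "real ?d \<le> top_sum r (card T)" using sum_le_top_sum[of r T] sum_r by simp
      also have "\<dots> \<le> real (?d - 1)"
        using not_less_Least[of "card T" "\<lambda>k. top_sum r k > real (?d - 1)"] small
        by (simp add: k_index_def)
      finally show False using assms(1) by simp
    qed
    from sum_less_of_k_index[OF r0 small this] show ?thesis using assms(1) by (simp add: of_nat_diff)
  qed
  obtain \<epsilon> where \<epsilon>: "0 < \<epsilon>" and near: "\<And>s :: real ^ 'n. (\<forall>i. 0 < s $ i) \<Longrightarrow>
      (\<Sum>i\<in>UNIV. s $ i) = real ?d \<Longrightarrow> (\<forall>i. \<bar>s $ i - r $ i\<bar> < \<epsilon>) \<Longrightarrow> spread_out ?d s"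
    using spread_out_near[of ?d r] r1 rT by auto
  show ?thesis
  proof (intro exI[of _ \<epsilon>] conjI allI impI \<epsilon>)
    fix s :: "real ^ 'n"
    assume "pos_rational_vec s" "admissible ?d s" "\<forall>i. \<bar>s $ i - r $ i\<bar> < \<epsilon>"
    then have "spread_out ?d s" by (intro near) (auto simp: pos_rational_vec_def admissible_def)
    then show "path_connected (parseval_frames s :: (real ^ 'n ^ 'd) set)"
      using assms(2) by (rule path_connected_parseval_frames)
  qed
qed

end
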